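(* Let $f_{xxx}$ be a ternary cubic form over $\mathbb{C}$. The following are equivalent: (1) $\Delta_{xxx}=0$ and $F_{6u}\neq 0$. (2) $f_{xxx}=a_x^3+b_x^3$ for some linearly independent linear forms $a_x,b_x$. (3) $f_{xxx}=a_xb_xc_x$ for some linear forms $a_x,b_x,c_x$ that are linearly dependent but pairwise linearly independent. (4) $\operatorname{rank}[f_{xxx}]=2$.
   Context: All forms are homogeneous polynomials with complex coefficients in $x_1,x_2,x_3$ (the zero polynomial is allowed); subscripts indicate degree, so $a_x=a_1x_1+a_2x_2+a_3x_3$ is a linear form and $f_{xxx}$ a cubic form. Let $u_1,u_2,u_3$ be further independent variables and $u_x=u_1x_1+u_2x_2+u_3x_3$. Rank: for a form $f$ of degree $d$, $\operatorname{rank}[f]$ (Waring rank) is the smallest integer $r\ge 0$ such that $f$ is a sum of $r$ $d$-th powers of linear forms in $\mathbb{C}[x_1,x_2,x_3]$. Transvectants: for forms $f,g,h$ in $x_1,x_2,x_3$ (whose coefficients may be polynomials in $u_1,u_2,u_3$, treated as constants), $\mathcal{J}_n[f,g,h]$ is obtained by applying $\Omega^n$ to $f(x)g(y)h(z)$, where $x,y,z$ are three independent triples of variables and $\Omega$ is the differential operator given by the $3\times 3$ determinant with rows $(\partial/\partial x_i)_i$, $(\partial/\partial y_i)_i$, $(\partial/\partial z_i)_i$, and then setting $y=z=x$. Concomitants of $f_{xxx}$: $\theta_{uuxx}=\frac14\mathcal{J}_2[f_{xxx},f_{xxx},u_x^2]$; the Hessian $\Delta_{xxx}=\frac1{12}\mathcal{J}_2[f_{xxx},f_{xxx},f_{xxx}]$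 (a cubic form in $x_1,x_2,x_3$); $F_{6u}=\frac1{3072}\mathcal{J}_2[\theta_{uuxx},\theta_{uuxx},u_x^2]$ (a form of degree 6 in $u_1,u_2,u_3$). Equations such as $\Delta_{xxx}=0$ mean identical vanishing as polynomials. *)

theory Defs
  imports
    "HOL-Analysis.Analysis"
    "HOL-Library.Poly_Mapping"
    "HOL-Library.Extended_Nat"
    "HOL-Combinatorics.Permutations"
begin

(* All polynomials live in one ring over the complex numbers, with the four triples of
   variables x, y, z, u. In the index type 3 the numerals 1, 2, 3 denote its three
   distinct elements (and 3 = 0 there). *)

datatype var = X 3 | Y 3 | Z 3 | U 3

type_synonym mon = "var \<Rightarrow>\<^sub>0 nat"
type_synonym mpoly = "mon \<Rightarrow>\<^sub>0 complex"

definition Const :: "complex \<Rightarrow> mpoly" where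
  "Const c = Poly_Mapping.single 0 c"

definition Var :: "var \<Rightarrow> mpoly" where
  "Var v = Poly_Mapping.single (Poly_Mapping.single v 1) 1"

(* The zero polynomial is a form of every degree. *)
definition is_form :: "nat \<Rightarrow> mpoly \<Rightarrow> bool" where
  "is_form d p \<longleftrightarrow>
     (\<forall>m \<in> Poly_Mapping.keys p.
        Poly_Mapping.keys m \<subseteq> range X \<and> (\<Sum>i\<in>UNIV. Poly_Mapping.lookup m (X i)) = d)"

definition scale :: "complex \<Rightarrow> mpoly \<Rightarrow> mpoly" where
  "scale c p = Const c * p"

global_interpretation mpoly: vector_space scale
proof
  fix a b :: complex and p q :: mpoly
  show "scale a (p + q) = scale a p + scale a q"
    by (simp add: scale_def distrib_left)
  show "scale (a + b) p = scale a p + scale b p"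
    by (simp add: scale_def Const_def single_add distrib_right)
  show "scale a (scale b p) = scale (a * b) p"
    by (simp add: scale_def Const_def mult_single flip: mult.assoc)
  show "scale 1 p = p"
    by (simp add: scale_def Const_def)
qed

(* Linear independence of a finite family; the library's notion is for sets, so repeated
   members have to be excluded separately. *)
definition lin_indep :: "mpoly list \<Rightarrow> bool" where
  "lin_indep ps \<longleftrightarrow> distinct ps \<and> mpoly.independent (set ps)"

(* Infinite if there is no decomposition (which can happen only for d = 0). The degree is
   an argument because the zero form does not determine it. *)
definition waring_rank :: "nat \<Rightarrow> mpoly \<Rightarrow> enat" where
  "waring_rank d f =
     Inf {enat r | r. \<exists>l :: nat \<Rightarrow> mpoly. (\<forall>i<r. is_form 1 (l i)) \<and> f = (\<Sum>i<r. l i ^ d)}"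

(* Where v does not occur in m, the truncated exponent is harmless: the coefficient is 0. *)
definition pd :: "var \<Rightarrow> mpoly \<Rightarrow> mpoly" where
  "pd v p = (\<Sum>m\<in>Poly_Mapping.keys p.
     Poly_Mapping.single (m - Poly_Mapping.single v 1)
       (of_nat (Poly_Mapping.lookup m v) * Poly_Mapping.lookup p m))"

definition rename_vars :: "(var \<Rightarrow> var) \<Rightarrow> mpoly \<Rightarrow> mpoly" where
  "rename_vars s p = (\<Sum>m\<in>Poly_Mapping.keys p.
     Const (Poly_Mapping.lookup p m) *
       (\<Prod>v\<in>Poly_Mapping.keys m. Var (s v) ^ Poly_Mapping.lookup m v))"

fun x_to_y :: "var \<Rightarrow> var" where
  "x_to_y (X i) = Y i" | "x_to_y v = v"

fun x_to_z :: "var \<Rightarrow> var" where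
  "x_to_z (X i) = Z i" | "x_to_z v = v"

fun yz_to_x :: "var \<Rightarrow> var" where
  "yz_to_x (Y i) = X i" | "yz_to_x (Z i) = X i" | "yz_to_x v = v"

(* Leibniz expansion of the determinant with rows d/dx, d/dy, d/dz *)
definition Omega :: "mpoly \<Rightarrow> mpoly" where
  "Omega P = (\<Sum>p | p permutes (UNIV :: 3 set).
     scale (of_int (sign p)) (pd (X (p 1)) (pd (Y (p 2)) (pd (Z (p 3)) P))))"

definition transvectant :: "nat \<Rightarrow> mpoly \<Rightarrow> mpoly \<Rightarrow> mpoly \<Rightarrow> mpoly" where
  "transvectant n f g h =
     rename_vars yz_to_x ((Omega ^^ n) (f * rename_vars x_to_y g * rename_vars x_to_z h))"

definition u_x :: mpoly where
  "u_x = (\<Sum>i\<in>UNIV. Var (U i) * Var (X i))"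

definition theta_uuxx :: "mpoly \<Rightarrow> mpoly" where
  "theta_uuxx f = scale (1/4) (transvectant 2 f f (u_x\<^sup>2))"

definition Delta_xxx :: "mpoly \<Rightarrow> mpoly" where
  "Delta_xxx f = scale (1/12) (transvectant 2 f f f)"

definition F_6u :: "mpoly \<Rightarrow> mpoly" where
  "F_6u f = scale (1/3072) (transvectant 2 (theta_uuxx f) (theta_uuxx f) (u_x\<^sup>2))"

end

theory Submission
  imports Defs "HOL-Computational_Algebra.Fundamental_Theorem_Algebra"
begin

text \<open>
  With \<open>H\<close> the Hessian matrix of \<open>f\<close>, one finds \<open>\<Delta> = det H / 2\<close> and \<open>\<theta> = u\<^sup>T adj(H) u\<close>, and \<open>F\<close> is
  proportional to \<open>u\<^sup>T adj(Hess \<theta>) u\<close>. If \<open>\<Delta> = 0\<close> and \<open>F \<noteq> 0\<close>, then \<open>\<theta>(x, u) \<noteq> 0\<close> for some \<open>x\<close>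
  and \<open>u\<close>, and the singular point \<open>w = adj(H(x)) u\<close> of \<open>f\<close> forces \<open>f\<close> to depend, in suitable
  coordinates, on two variables only, or to be of the form \<open>a\<^sup>2 b\<close>. Either way \<open>f\<close> is a product of
  three linear forms from a two-dimensional space. They are pairwise independent since
  \<open>F = 0\<close> for \<open>f = a\<^sup>2 b\<close>, whereas \<open>F\<close> is proportional to \<open>det(u, a, b)\<^sup>6\<close> for \<open>f = a\<^sup>3 + b\<^sup>3\<close>. The
  vanishing of \<open>F\<close> on \<open>a\<^sup>2 b\<close> also excludes rank at most one.
\<close>

section \<open>Evaluation and substitution\<close>

text \<open>The coefficient map \<open>h\<close> is kept general so that evaluation at a point
  (\<open>h\<close> the identity) and renaming of variables (\<open>h = Const\<close>) share one set
  of homomorphism laws.\<close>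

definition insertion :: "(complex \<Rightarrow> 'a::comm_ring_1) \<Rightarrow> (var \<Rightarrow> 'a) \<Rightarrow> mpoly \<Rightarrow> 'a" where
  "insertion h \<sigma> p = (\<Sum>m\<in>Poly_Mapping.keys p.
     h (Poly_Mapping.lookup p m) * (\<Prod>v\<in>Poly_Mapping.keys m. \<sigma> v ^ Poly_Mapping.lookup m v))"

lemma sum_keys_superset:
  assumes "finite A" "Poly_Mapping.keys p \<subseteq> A" "\<And>m. g m 0 = (0::'a::comm_monoid_add)"
  shows "(\<Sum>m\<in>Poly_Mapping.keys p. g m (Poly_Mapping.lookup p m)) = (\<Sum>m\<in>A. g m (Poly_Mapping.lookup p m))"
  by (rule sum.mono_neutral_left) (use assms in \<open>auto simp: in_keys_iff\<close>)

text \<open>Both supports, and that of \<open>p + q\<close>, are enlarged to their union; terms with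
  coefficient 0 contribute nothing, so cancellation in \<open>p + q\<close> is harmless. This gives
  additivity of \<open>insertion\<close> and of \<open>pd\<close>.\<close>

lemma sum_keys_add:
  assumes "\<And>m. g m 0 = (0::'a::comm_monoid_add)" "\<And>m a b. g m (a + b) = g m a + g m b"
  shows "(\<Sum>m\<in>Poly_Mapping.keys (p + q). g m (Poly_Mapping.lookup (p + q) m)) =
    (\<Sum>m\<in>Poly_Mapping.keys p. g m (Poly_Mapping.lookup p m)) +
    (\<Sum>m\<in>Poly_Mapping.keys q. g m (Poly_Mapping.lookup q m))"
proof -
  let ?A = "Poly_Mapping.keys p \<union> Poly_Mapping.keys q"
  show ?thesis
    using assms keys_add[of p q]
      sum_keys_superset[of ?A "p + q" g] sum_keys_superset[of ?A p g] sum_keys_superset[of ?A q g]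
    by (simp only: lookup_add sum.distrib) simp
qed

lemma sum_keys_single:
  assumes "g m 0 = (0::'a::comm_monoid_add)"
  shows "(\<Sum>k\<in>Poly_Mapping.keys (Poly_Mapping.single m c). g k (Poly_Mapping.lookup (Poly_Mapping.single m c) k)) = g m c"
  using assms by (cases "c = 0") auto

lemma mpoly_eq_sum_single:
  "(p :: 'a \<Rightarrow>\<^sub>0 'b::comm_monoid_add) = (\<Sum>m\<in>Poly_Mapping.keys p. Poly_Mapping.single m (Poly_Mapping.lookup p m))"
  by (rule poly_mapping_eqI)
    (simp add: lookup_sum lookup_single sum.delta when_def in_keys_iff)

lemma poly_mapping_single_induct [case_names single add]:
  fixes p :: "'a \<Rightarrow>\<^sub>0 'b::comm_monoid_add"
  assumes "\<And>m c. P (Poly_Mapping.single m c)" "\<And>p q. P p \<Longrightarrow> P q \<Longrightarrow> P (p + q)"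
  shows "P p"
proof -
  \<comment> \<open>The empty sum is covered by the monomial case, since a monomial with coefficient
    0 is the zero polynomial.\<close>
  have "P (\<Sum>m\<in>A. Poly_Mapping.single m (Poly_Mapping.lookup p m))" if "finite A" for A
    using that by induction (use assms assms(1)[of undefined 0] in auto)
  from this[of "Poly_Mapping.keys p"] show ?thesis
    by (simp flip: mpoly_eq_sum_single)
qed

lemma finite_var: "finite (UNIV :: var set)"
proof -
  have "UNIV = range X \<union> range Y \<union> range Z \<union> range U"
  proof (intro equalityI subsetI)
    show "v \<in> range X \<union> range Y \<union> range Z \<union> range U" for v
      by (cases v) auto
  qed auto
  then show ?thesis
    by (metis finite_Un finite_class.finite_UNIV finite_imageI)
qed

lemma prod_keys_eq_prod_UNIV:
  fixes \<sigma> :: "var \<Rightarrow> 'a::comm_monoid_mult"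
  shows "(\<Prod>v\<in>Poly_Mapping.keys m. \<sigma> v ^ Poly_Mapping.lookup m v) = (\<Prod>v\<in>UNIV. \<sigma> v ^ Poly_Mapping.lookup m v)"
  by (rule prod.mono_neutral_left) (auto simp: finite_var in_keys_iff)

locale insertion_hom =
  fixes h :: "complex \<Rightarrow> 'a::comm_ring_1"
  assumes h_add: "h (a + b) = h a + h b"
    and h_mult: "h (a * b) = h a * h b"
    and h_1: "h 1 = 1"
begin

lemma h_0: "h 0 = 0"
  using h_add[of 0 0] by simp

lemma insertion_add: "insertion h \<sigma> (p + q) = insertion h \<sigma> p + insertion h \<sigma> q"
  unfolding insertion_def
  by (rule sum_keys_add[where g = "\<lambda>m c. h c * _ m"]) (simp_all add: h_0 h_add distrib_right)

lemma insertion_single: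
  "insertion h \<sigma> (Poly_Mapping.single m c) =
    h c * (\<Prod>v\<in>Poly_Mapping.keys m. \<sigma> v ^ Poly_Mapping.lookup m v)"
  unfolding insertion_def
  by (rule sum_keys_single[where g = "\<lambda>m c. h c * _ m"]) (simp add: h_0)

lemma insertion_mult: "insertion h \<sigma> (p * q) = insertion h \<sigma> p * insertion h \<sigma> q"
proof (induction p rule: poly_mapping_single_induct)
  case (single m c)
  show ?case
  proof (induction q rule: poly_mapping_single_induct)
    case (single n d)
    show ?case
      unfolding mult_single insertion_single prod_keys_eq_prod_UNIV
      by (simp add: h_mult lookup_add power_add prod.distrib)
  qed (simp add: distrib_left insertion_add)
qed (simp add: distrib_right insertion_add)

lemma insertion_Const: "insertion h \<sigma> (Const c) = h c"
  by (simp add: Const_def insertion_single)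

lemma insertion_Var: "insertion h \<sigma> (Var v) = \<sigma> v"
  by (simp add: Var_def insertion_single h_1)

lemma insertion_1: "insertion h \<sigma> 1 = 1"
  using insertion_Const[of \<sigma> 1] by (simp add: Const_def h_1)

lemma insertion_power: "insertion h \<sigma> (p ^ n) = insertion h \<sigma> p ^ n"
  by (induction n) (simp_all add: insertion_1 insertion_mult)

lemma insertion_0: "insertion h \<sigma> 0 = 0"
  by (simp add: insertion_def)

lemma insertion_sum: "insertion h \<sigma> (\<Sum>i\<in>A. p i) = (\<Sum>i\<in>A. insertion h \<sigma> (p i))"
  by (induction A rule: infinite_finite_induct) (simp_all add: insertion_0 insertion_add)

end

lemma Const_add: "Const (a + b) = Const a + Const b"
  by (simp add: Const_def single_add)

lemma Const_mult: "Const (a * b) = Const a * Const b"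
  by (simp add: Const_def mult_single)

lemma Const_uminus: "Const (- a) = - Const a"
  by (simp add: Const_def single_uminus)

lemma Const_0 [simp]: "Const 0 = 0"
  by (simp add: Const_def)

lemma Const_1 [simp]: "Const 1 = 1"
  by (simp add: Const_def)

lemma Const_numeral [simp]: "Const (numeral n) = numeral n"
  by (simp add: Const_def)

lemma Const_power: "Const (a ^ n) = Const a ^ n"
  by (induction n) (simp_all add: Const_mult)

interpretation Const: insertion_hom Const
  by standard (simp_all add: Const_add Const_mult)

interpretation id: insertion_hom "\<lambda>c. c"
  by standard simp_all

abbreviation "eval \<equiv> insertion (\<lambda>c. c)"

lemmas eval_simps = id.insertion_add id.insertion_mult id.insertion_Const id.insertion_Var
  id.insertion_1 id.insertion_power id.insertion_0 id.insertion_sum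

lemma rename_vars_eq: "rename_vars s = insertion Const (\<lambda>v. Var (s v))"
  by (simp add: fun_eq_iff rename_vars_def insertion_def)

lemmas rename_simps = Const.insertion_add Const.insertion_mult Const.insertion_Const
  Const.insertion_Var Const.insertion_1 Const.insertion_power Const.insertion_0 Const.insertion_sum

lemmas rename_vars_simps = rename_simps[where \<sigma> = "\<lambda>v. Var (s v)" for s, folded rename_vars_eq]

lemma eval_numeral [simp]: "eval \<sigma> (numeral n) = numeral n"
  using id.insertion_Const[of \<sigma> "numeral n"] by simp

text \<open>Uniqueness of base-\<open>N\<close> expansions: \<open>mod N\<close> reads off the
  lowest digit, and \<open>div N\<close> leaves the remaining ones for the induction.\<close>

lemma digits_inj:
  fixes N :: nat
  assumes "(\<Sum>i<n. a i * N ^ i) = (\<Sum>i<n. b i * N ^ i)" "\<And>i. i < n \<Longrightarrow> a i < N" "\<And>i. i < n \<Longrightarrow> b i < N" "i < n"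
  shows "a i = b i"
  using assms
proof (induction n arbitrary: a b i)
  case (Suc n)
  have shift: "(\<Sum>i<Suc n. c i * N ^ i) = c 0 + N * (\<Sum>i<n. c (Suc i) * N ^ i)" for c
    by (subst sum.lessThan_Suc_shift) (simp add: sum_distrib_left mult_ac)
  have eq: "a 0 + N * (\<Sum>i<n. a (Suc i) * N ^ i) = b 0 + N * (\<Sum>i<n. b (Suc i) * N ^ i)"
    using Suc.prems(1) unfolding shift .
  have lt: "a 0 < N" "b 0 < N"
    using Suc.prems by auto
  have "a 0 = b 0"
    using arg_cong[OF eq, of "\<lambda>x. x mod N"] lt by simp
  moreover have "(\<Sum>i<n. a (Suc i) * N ^ i) = (\<Sum>i<n. b (Suc i) * N ^ i)"
    using arg_cong[OF eq, of "\<lambda>x. x div N"] lt by simp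
  then have "a (Suc i) = b (Suc i)" if "i < n" for i
    using Suc.IH[of "\<lambda>i. a (Suc i)" "\<lambda>i. b (Suc i)" i] Suc.prems that by simp
  ultimately show ?case
    using Suc.prems(4) by (cases i) auto
qed simp

text \<open>Kronecker substitution \<open>v \<mapsto> t ^ N ^ e v\<close> separates the monomials of a polynomial.\<close>

lemma eval_eq_0D:
  assumes "\<And>\<sigma>. eval \<sigma> p = 0"
  shows "p = 0"
proof -
  obtain e :: "var \<Rightarrow> nat" and n where e: "bij_betw e UNIV {..<n}"
    using ex_bij_betw_finite_nat[OF finite_var] by (metis atLeast0LessThan)
  let ?K = "Poly_Mapping.keys p"
  \<comment> \<open>One more than the sum of all exponents in \<open>p\<close>, hence larger than
    each of them, so exponents are genuine base-\<open>N\<close> digits and \<open>\<phi>\<close> is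
    injective on the monomials of \<open>p\<close>.\<close>
  define N where "N = Suc (\<Sum>m\<in>?K. \<Sum>v\<in>UNIV. Poly_Mapping.lookup m v)"
  define \<phi> where "\<phi> m = (\<Sum>v\<in>UNIV. Poly_Mapping.lookup m v * N ^ e v)" for m :: mon
  have less: "Poly_Mapping.lookup m v < N" if "m \<in> ?K" for m v
  proof -
    have "Poly_Mapping.lookup m v \<le> (\<Sum>v\<in>UNIV. Poly_Mapping.lookup m v)"
      by (rule member_le_sum) (auto simp: finite_var)
    also have "\<dots> \<le> (\<Sum>m\<in>?K. \<Sum>v\<in>UNIV. Poly_Mapping.lookup m v)"
      by (rule member_le_sum) (auto simp: that)
    finally show ?thesis
      by (simp add: N_def)
  qed
  have inj: "inj_on \<phi> ?K"
  proof (rule inj_onI, rule poly_mapping_eqI)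
    fix m k v assume mk: "m \<in> ?K" "k \<in> ?K" "\<phi> m = \<phi> k"
    let ?e' = "inv_into UNIV e"
    have \<phi>: "\<phi> m = (\<Sum>i<n. Poly_Mapping.lookup m (?e' i) * N ^ i)" for m
      unfolding \<phi>_def
      by (subst sum.reindex_bij_betw[OF e, symmetric]) (simp add: bij_betw_inv_into_left[OF e])
    have "Poly_Mapping.lookup m (?e' (e v)) = Poly_Mapping.lookup k (?e' (e v))"
    proof (rule digits_inj[where a = "\<lambda>i. Poly_Mapping.lookup m (?e' i)" and b = "\<lambda>i. Poly_Mapping.lookup k (?e' i)"])
      show "(\<Sum>i<n. Poly_Mapping.lookup m (?e' i) * N ^ i) = (\<Sum>i<n. Poly_Mapping.lookup k (?e' i) * N ^ i)"
        using mk(3) by (simp only: \<phi>)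
      show "e v < n"
        using e by (auto simp: bij_betw_def)
    qed (use mk less in auto)
    then show "Poly_Mapping.lookup m v = Poly_Mapping.lookup k v"
      by (simp add: bij_betw_inv_into_left[OF e])
  qed
  define P where "P = (\<Sum>m\<in>?K. monom (Poly_Mapping.lookup p m) (\<phi> m))"
  have "poly P t = eval (\<lambda>v. t ^ N ^ e v) p" for t
  proof -
    have "(\<Prod>v\<in>Poly_Mapping.keys m. (t ^ N ^ e v) ^ Poly_Mapping.lookup m v) = t ^ \<phi> m" for m
      by (simp add: prod_keys_eq_prod_UNIV \<phi>_def power_sum mult.commute[of "Poly_Mapping.lookup m _"] power_mult)
    then show ?thesis
      by (simp add: P_def insertion_def poly_sum poly_monom)
  qed
  then have "P = 0"
    using assms by (simp flip: poly_all_0_iff_0)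
  have "Poly_Mapping.lookup p m = 0" if "m \<in> ?K" for m
  proof -
    \<comment> \<open>By injectivity of \<open>\<phi>\<close>, no two terms of \<open>P\<close>
      share a degree, so its coefficients are exactly those of \<open>p\<close>.\<close>
    have "coeff P (\<phi> m) = (\<Sum>k\<in>?K. if k = m then Poly_Mapping.lookup p k else 0)"
      unfolding P_def coeff_sum coeff_monom
      by (rule sum.cong) (use inj that in \<open>auto simp: inj_on_def\<close>)
    then show ?thesis
      using that \<open>P = 0\<close> by simp
  qed
  then show ?thesis
    by (intro poly_mapping_eqI) (metis in_keys_iff lookup_zero)
qed

lemma eval_eqI:
  assumes "\<And>\<sigma>. eval \<sigma> p = eval \<sigma> q"
  shows "p = q"
proof -
  have "eval \<sigma> (p + Const (-1) * q) = 0" for \<sigma>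
    by (simp add: eval_simps assms)
  then have "p + Const (-1) * q = 0"
    by (rule eval_eq_0D)
  then show ?thesis
    by (simp add: Const_uminus)
qed

section \<open>Derivatives and transvectants\<close>

lemma pd_add: "pd v (p + q) = pd v p + pd v q"
  unfolding pd_def
  by (rule sum_keys_add[where g = "\<lambda>m c. Poly_Mapping.single (_ m) (_ m * c)"])
    (simp_all add: distrib_left single_add)

lemma pd_single:
  "pd v (Poly_Mapping.single m c) =
    Poly_Mapping.single (m - Poly_Mapping.single v 1) (of_nat (Poly_Mapping.lookup m v) * c)"
  unfolding pd_def
  by (rule sum_keys_single[where g = "\<lambda>m c. Poly_Mapping.single (_ m) (_ m * c)"]) simp

lemma pd_mult: "pd v (p * q) = pd v p * q + p * pd v q"
proof (induction p rule: poly_mapping_single_induct)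
  case (single m c)
  show ?case
  proof (induction q rule: poly_mapping_single_induct)
    case (single n d)
    \<comment> \<open>If \<open>v\<close> occurs in \<open>m\<close>, the truncated subtraction is
      exact and may be carried out in that factor. If it does not, the corresponding term has
      coefficient 0.\<close>
    have *: "m + n - Poly_Mapping.single v 1 = (m - Poly_Mapping.single v 1) + n"
      if "Poly_Mapping.lookup m v \<noteq> 0" for m n :: mon
      by (rule poly_mapping_eqI) (use that in \<open>auto simp: lookup_add lookup_minus lookup_single when_def\<close>)
    show ?case
      using *[of m n] *[of n m]
      by (cases "Poly_Mapping.lookup m v = 0"; cases "Poly_Mapping.lookup n v = 0")
        (auto simp: pd_single mult_single lookup_add algebra_simps simp flip: single_add)
  qed (simp add: distrib_left pd_add)
qed (simp add: distrib_right pd_add)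

lemma pd_Const [simp]: "pd v (Const c) = 0"
  by (simp add: Const_def pd_single)

lemma pd_Var: "pd v (Var w) = (if v = w then 1 else 0)"
  by (auto simp: Var_def pd_single lookup_single when_def)

lemma pd_0 [simp]: "pd v 0 = 0"
  using pd_Const[of v 0] by simp

lemma pd_numeral [simp]: "pd v (numeral n) = 0"
  using pd_Const[of v "numeral n"] by simp

lemma pd_uminus: "pd v (- p) = - pd v p"
  using pd_add[of v p "- p"] by (simp add: eq_neg_iff_add_eq_0 add.commute)

lemma pd_diff: "pd v (p - q) = pd v p - pd v q"
  using pd_add[of v p "- q"] by (simp add: pd_uminus)

lemma pd_sum: "pd v (\<Sum>i\<in>A. p i) = (\<Sum>i\<in>A. pd v (p i))"
  by (induction A rule: infinite_finite_induct) (simp_all add: pd_add)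

lemma pd_power2: "pd v (p\<^sup>2) = 2 * p * pd v p"
  by (simp add: power2_eq_square pd_mult)

lemma pd_scale: "pd v (scale c p) = scale c (pd v p)"
  by (simp add: scale_def pd_mult)

text \<open>The subalgebra generated by the variables in \<open>V\<close>. The inductive description
  lets facts about derivatives and renamings be proved along the construction of a polynomial,
  without looking at its monomials.\<close>

inductive_set polys_in :: "var set \<Rightarrow> mpoly set" for V where
  Const [intro]: "Const c \<in> polys_in V"
| Var [intro]: "v \<in> V \<Longrightarrow> Var v \<in> polys_in V"
| add [intro]: "p \<in> polys_in V \<Longrightarrow> q \<in> polys_in V \<Longrightarrow> p + q \<in> polys_in V"
| mult [intro]: "p \<in> polys_in V \<Longrightarrow> q \<in> polys_in V \<Longrightarrow> p * q \<in> polys_in V"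

abbreviation "polys_XU \<equiv> polys_in (range X \<union> range U)"

lemma polys_in_1 [intro]: "1 \<in> polys_in V"
  using polys_in.Const[of 1 V] by simp

lemma polys_in_0 [intro]: "0 \<in> polys_in V"
  using polys_in.Const[of 0 V] by simp

lemma polys_in_numeral [intro]: "numeral n \<in> polys_in V"
  using polys_in.Const[of "numeral n" V] by simp

lemma polys_in_uminus [intro]: "p \<in> polys_in V \<Longrightarrow> - p \<in> polys_in V"
  using polys_in.mult[OF polys_in.Const[of "-1" V]] by (simp add: Const_uminus)

lemma polys_in_diff [intro]: "p \<in> polys_in V \<Longrightarrow> q \<in> polys_in V \<Longrightarrow> p - q \<in> polys_in V"
  using polys_in.add polys_in_uminus by fastforce

lemma polys_in_power [intro]: "p \<in> polys_in V \<Longrightarrow> p ^ n \<in> polys_in V"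
  by (induction n) auto

lemma polys_in_sum [intro]: "(\<And>i. i \<in> A \<Longrightarrow> p i \<in> polys_in V) \<Longrightarrow> (\<Sum>i\<in>A. p i) \<in> polys_in V"
  by (induction A rule: infinite_finite_induct) auto

lemma polys_in_pd [intro]: "p \<in> polys_in V \<Longrightarrow> pd v p \<in> polys_in V"
  by (induction rule: polys_in.induct) (auto simp: pd_add pd_mult pd_Var)

lemma pd_eq_0: "p \<in> polys_in V \<Longrightarrow> v \<notin> V \<Longrightarrow> pd v p = 0"
  by (induction rule: polys_in.induct) (auto simp: pd_add pd_mult pd_Var)

lemma rename_vars_in: "p \<in> polys_in V \<Longrightarrow> rename_vars s p \<in> polys_in (s ` V)"
  by (induction rule: polys_in.induct) (auto simp: rename_vars_simps)

text \<open>Injectivity on \<open>insert v V\<close> guarantees that no other variable of the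
  polynomial is renamed to \<open>s v\<close>.\<close>

lemma pd_rename_vars:
  "p \<in> polys_in V \<Longrightarrow> inj_on s (insert v V) \<Longrightarrow> pd (s v) (rename_vars s p) = rename_vars s (pd v p)"
  by (induction rule: polys_in.induct)
    (auto simp: pd_add pd_mult pd_Var rename_vars_simps inj_on_def)

lemma rename_vars_id:
  "p \<in> polys_in V \<Longrightarrow> (\<And>v. v \<in> V \<Longrightarrow> s v = v) \<Longrightarrow> rename_vars s p = p"
  by (induction rule: polys_in.induct) (auto simp: rename_vars_simps)

lemma rename_vars_cancel:
  "p \<in> polys_in V \<Longrightarrow> (\<And>v. v \<in> V \<Longrightarrow> t (s v) = v) \<Longrightarrow> rename_vars t (rename_vars s p) = p"
  by (induction rule: polys_in.induct) (auto simp: rename_vars_simps)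

section \<open>The operator \<open>Omega\<close> and second transvectants\<close>

lemma Omega_add: "Omega (p + q) = Omega p + Omega q"
  by (simp add: Omega_def pd_add mpoly.scale_right_distrib sum.distrib)

lemma Omega_scale: "Omega (scale c p) = scale c (Omega p)"
  unfolding Omega_def mpoly.scale_sum_right
  by (rule sum.cong) (simp_all add: pd_scale mpoly.scale_left_commute)

lemma Omega_sum: "Omega (\<Sum>i\<in>A. p i) = (\<Sum>i\<in>A. Omega (p i))"
proof -
  have "Omega 0 = 0"
    by (simp add: Omega_def scale_def)
  then show ?thesis
    by (induction A rule: infinite_finite_induct) (simp_all add: Omega_add)
qed

text \<open>After renaming, each of the triples x, y, z occurs in only one factor, while the u are
  constants. Hence each derivative acts on a single factor.\<close>

lemma pd_factors:
  assumes "f \<in> polys_XU" "g \<in> polys_XU" "h \<in> polys_XU"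
  shows "pd (X i) (pd (Y j) (pd (Z k) (f * rename_vars x_to_y g * rename_vars x_to_z h))) =
    pd (X i) f * rename_vars x_to_y (pd (X j) g) * rename_vars x_to_z (pd (X k) h)"
proof -
  have y: "rename_vars x_to_y g \<in> polys_in (range Y \<union> range U)" if "g \<in> polys_XU" for g
    using rename_vars_in[OF that, of x_to_y] by (simp add: image_Un image_image)
  have z: "rename_vars x_to_z h \<in> polys_in (range Z \<union> range U)" if "h \<in> polys_XU" for h
    using rename_vars_in[OF that, of x_to_z] by (simp add: image_Un image_image)
  have inj_y: "inj_on x_to_y (range X \<union> range U)" and inj_z: "inj_on x_to_z (range X \<union> range U)"
    by (auto intro!: inj_onI)
  have [simp]: "pd (Y j) (rename_vars x_to_y g) = rename_vars x_to_y (pd (X j) g)"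
    using pd_rename_vars[OF assms(2) inj_on_subset[OF inj_y], of "X j"] by auto
  have [simp]: "pd (Z k) (rename_vars x_to_z h) = rename_vars x_to_z (pd (X k) h)"
    using pd_rename_vars[OF assms(3) inj_on_subset[OF inj_z], of "X k"] by auto
  have [simp]: "pd (Z k) f = 0" "pd (Y j) f = 0"
    using assms(1) by (auto intro!: pd_eq_0)
  have [simp]: "pd (Z k) (rename_vars x_to_y g) = 0"
     "pd (X i) (rename_vars x_to_y (pd (X j) g)) = 0"
    using assms(2) by (auto intro!: pd_eq_0[OF y])
  have [simp]: "pd (Y j) (rename_vars x_to_z (pd (X k) h)) = 0"
     "pd (X i) (rename_vars x_to_z (pd (X k) h)) = 0"
    using assms(3) by (auto intro!: pd_eq_0[OF z])
  show ?thesis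
    by (simp add: pd_mult)
qed

text \<open>The result is again a combination of products of the same shape, so a second
  \<open>Omega\<close> can be computed by the same rule.\<close>

lemma Omega_factors:
  assumes "f \<in> polys_XU" "g \<in> polys_XU" "h \<in> polys_XU"
  shows "Omega (f * rename_vars x_to_y g * rename_vars x_to_z h) =
    (\<Sum>p | p permutes (UNIV :: 3 set). scale (of_int (sign p))
      (pd (X (p 1)) f * rename_vars x_to_y (pd (X (p 2)) g) * rename_vars x_to_z (pd (X (p 3)) h)))"
  by (simp add: Omega_def pd_factors[OF assms])

lemma sum_permutes_3:
  "(\<Sum>p | p permutes (UNIV :: 3 set). g (sign p) (p 1) (p 2) (p 3)) =
    g 1 1 2 3 + g 1 2 3 1 + g 1 3 1 2 + g (- 1) 1 3 2 + g (- 1) 2 1 3 + (g (- 1) 3 2 1 :: 'a::comm_monoid_add)"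
proof -
  have f123: "finite {2::3, 3}" "1 \<notin> {2::3, 3}"
    and f23: "finite {3::3}" "2 \<notin> {3::3}"
    by auto
  show ?thesis
    unfolding UNIV_3 sum_over_permutations_insert[OF f123] sum_over_permutations_insert[OF f23] permutes_sing
    by (auto simp: sign_swap_id permutation_swap_id sign_compose sign_id Transposition.transpose_def add_ac)
qed

text \<open>Six times the full polarization of the 3x3 determinant, also known as the mixed
  discriminant up to normalization.\<close>

definition mixed_det :: "(3 \<Rightarrow> 3 \<Rightarrow> 'a::comm_ring_1) \<Rightarrow> (3 \<Rightarrow> 3 \<Rightarrow> 'a) \<Rightarrow> (3 \<Rightarrow> 3 \<Rightarrow> 'a) \<Rightarrow> 'a" where
  "mixed_det a b c = (\<Sum>p | p permutes (UNIV :: 3 set). \<Sum>q | q permutes (UNIV :: 3 set).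
     of_int (sign p) * of_int (sign q) * (a (p 1) (q 1) * b (p 2) (q 2) * c (p 3) (q 3)))"

text \<open>The two applications of \<open>Omega\<close> choose the permutations \<open>p\<close>
  and \<open>q\<close>, which index the first and the second derivative of each factor; setting y =
  z = x then undoes the renamings.\<close>

lemma transvectant_2:
  assumes "f \<in> polys_XU" "g \<in> polys_XU" "h \<in> polys_XU"
  shows "transvectant 2 f g h =
    mixed_det (\<lambda>i j. pd (X j) (pd (X i) f)) (\<lambda>i j. pd (X j) (pd (X i) g)) (\<lambda>i j. pd (X j) (pd (X i) h))"
proof -
  have x: "rename_vars yz_to_x f = f" if "f \<in> polys_XU" for f
    by (rule rename_vars_id[OF that]) auto
  have y: "rename_vars yz_to_x (rename_vars x_to_y f) = f" if "f \<in> polys_XU" for f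
    by (rule rename_vars_cancel[OF that]) auto
  have z: "rename_vars yz_to_x (rename_vars x_to_z f) = f" if "f \<in> polys_XU" for f
    by (rule rename_vars_cancel[OF that]) auto
  have c: "rename_vars yz_to_x (scale c p) = scale c (rename_vars yz_to_x p)" for c p
    by (simp add: scale_def rename_vars_simps)
  have s: "Const (of_int n) = of_int n" for n
    by (simp add: Const_def)
  show ?thesis
    using assms
    by (simp add: transvectant_def numeral_2_eq_2 mixed_det_def Omega_factors Omega_sum Omega_scale polys_in_pd
        rename_vars_simps c x y z)
      (simp add: scale_def s mult.assoc sum_distrib_left)
qed

section \<open>Ternary cubics with vanishing Hessian\<close>

definition trilinear :: "(3 \<Rightarrow> 3 \<Rightarrow> 3 \<Rightarrow> complex) \<Rightarrow> complex^3 \<Rightarrow> complex^3 \<Rightarrow> complex^3 \<Rightarrow> complex" where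
  "trilinear T x y z = (\<Sum>i\<in>UNIV. \<Sum>j\<in>UNIV. \<Sum>k\<in>UNIV. T i j k * x $ i * y $ j * z $ k)"

definition symmetric3 :: "(3 \<Rightarrow> 3 \<Rightarrow> 3 \<Rightarrow> complex) \<Rightarrow> bool" where
  "symmetric3 T \<longleftrightarrow> (\<forall>i j k. T i j k = T j i k \<and> T i j k = T i k j)"

text \<open>For symmetric \<open>T\<close> this is one sixth of the Hessian matrix, at the point
  \<open>v\<close>, of the cubic \<open>trilinear T v v v\<close>.\<close>

definition contract :: "(3 \<Rightarrow> 3 \<Rightarrow> 3 \<Rightarrow> complex) \<Rightarrow> complex^3 \<Rightarrow> complex^3^3" where
  "contract T v = (\<chi> i j. \<Sum>k\<in>UNIV. T i j k * v $ k)"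

text \<open>Bilinear, without complex conjugation, so that \<open>dot a\<close> is the linear form
  with coefficient vector \<open>a\<close>.\<close>

definition dot :: "complex^3 \<Rightarrow> complex^3 \<Rightarrow> complex" where
  "dot a v = (\<Sum>i\<in>UNIV. a $ i * v $ i)"

definition det3 :: "complex^3 \<Rightarrow> complex^3 \<Rightarrow> complex^3 \<Rightarrow> complex" where
  "det3 x y z = det (vector [x, y, z])"

lemma det3_eq:
  "det3 x y z = x$1 * (y$2 * z$3 - y$3 * z$2) + x$2 * (y$3 * z$1 - y$1 * z$3) + x$3 * (y$1 * z$2 - y$2 * z$1)"
  by (simp add: det3_def det_3 algebra_simps)

lemma trilinear_add:
  "trilinear T (x + x') y z = trilinear T x y z + trilinear T x' y z"
  "trilinear T x (y + y') z = trilinear T x y z + trilinear T x y' z"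
  "trilinear T x y (z + z') = trilinear T x y z + trilinear T x y z'"
  by (simp_all add: trilinear_def algebra_simps sum.distrib)

lemma trilinear_scale:
  "trilinear T (c *s x) y z = c * trilinear T x y z"
  "trilinear T x (c *s y) z = c * trilinear T x y z"
  "trilinear T x y (c *s z) = c * trilinear T x y z"
  by (simp_all add: trilinear_def sum_distrib_left mult_ac)

text \<open>Rewriting to sorted indices leaves the ten independent coefficients of a ternary cubic,
  after which identities are purely algebraic.\<close>

lemma symmetric3_sorted:
  assumes "symmetric3 T"
  shows "T 1 2 1 = T 1 1 2" "T 2 1 1 = T 1 1 2" "T 1 3 1 = T 1 1 3" "T 3 1 1 = T 1 1 3"
    "T 2 1 2 = T 1 2 2" "T 2 2 1 = T 1 2 2" "T 2 3 2 = T 2 2 3" "T 3 2 2 = T 2 2 3"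
    "T 3 1 3 = T 1 3 3" "T 3 3 1 = T 1 3 3" "T 3 2 3 = T 2 3 3" "T 3 3 2 = T 2 3 3"
    "T 1 3 2 = T 1 2 3" "T 2 1 3 = T 1 2 3" "T 2 3 1 = T 1 2 3" "T 3 1 2 = T 1 2 3" "T 3 2 1 = T 1 2 3"
proof -
  have "T i j k = T j i k" "T i j k = T i k j" for i j k
    using assms by (auto simp: symmetric3_def)
  then show "T 1 2 1 = T 1 1 2" "T 2 1 1 = T 1 1 2" "T 1 3 1 = T 1 1 3" "T 3 1 1 = T 1 1 3"
    "T 2 1 2 = T 1 2 2" "T 2 2 1 = T 1 2 2" "T 2 3 2 = T 2 2 3" "T 3 2 2 = T 2 2 3"
    "T 3 1 3 = T 1 3 3" "T 3 3 1 = T 1 3 3" "T 3 2 3 = T 2 3 3" "T 3 3 2 = T 2 3 3"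
    "T 1 3 2 = T 1 2 3" "T 2 1 3 = T 1 2 3" "T 2 3 1 = T 1 2 3" "T 3 1 2 = T 1 2 3" "T 3 2 1 = T 1 2 3"
    by metis+
qed

lemma trilinear_sym:
  assumes "symmetric3 T"
  shows "trilinear T x y z = trilinear T y x z" "trilinear T x y z = trilinear T x z y"
  unfolding trilinear_def sum_3 symmetric3_sorted[OF assms] by algebra+

lemma contract_sym:
  assumes "symmetric3 T"
  shows "contract T v $ i $ j = contract T v $ j $ i"
  using assms unfolding contract_def symmetric3_def by simp

lemma contract_add_scale:
  "contract T (x + t *s z) $ i $ j = contract T x $ i $ j + t * contract T z $ i $ j"
  by (simp add: contract_def sum_3 algebra_simps)

lemma trilinear_contract:
  "trilinear T p q v = (\<Sum>i\<in>UNIV. \<Sum>j\<in>UNIV. contract T v $ i $ j * p $ i * q $ j)"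
  by (simp add: trilinear_def contract_def sum_3 algebra_simps)

text \<open>The Gram matrix of \<open>p\<close>, \<open>q\<close>, \<open>r\<close> for the bilinear
  form \<open>trilinear T v\<close> is M H M^T with H = \<open>contract T v\<close>, so its
  determinant vanishes with det H. The claim is the expansion of this symmetric determinant.\<close>

lemma gram_det:
  assumes "symmetric3 T" "det (contract T v) = 0"
  shows "trilinear T v p p * trilinear T v q q * trilinear T v r r
    + 2 * trilinear T v p q * trilinear T v p r * trilinear T v q r
    = trilinear T v p p * (trilinear T v q r)\<^sup>2
    + trilinear T v q q * (trilinear T v p r)\<^sup>2
    + trilinear T v r r * (trilinear T v p q)\<^sup>2"
proof -
  let ?M = "vector [p, q, r] :: complex^3^3"
  let ?G = "?M ** contract T v ** transpose ?M"
  have G: "?G $ i $ j = trilinear T v (?M $ i) (?M $ j)" for i j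
  proof -
    have "?G $ i $ j = trilinear T (?M $ i) (?M $ j) v"
      by (simp add: matrix_matrix_mult_def transpose_def trilinear_contract sum_3 algebra_simps)
    then show ?thesis
      using trilinear_sym[OF assms(1)] by metis
  qed
  have "det ?G = 0"
    by (simp add: det_mul assms(2))
  moreover have "trilinear T v q p = trilinear T v p q" "trilinear T v r p = trilinear T v p r"
    "trilinear T v r q = trilinear T v q r"
    by (rule trilinear_sym(2)[OF assms(1)])+
  ultimately show ?thesis
    by (simp add: det_3 G) algebra
qed

text \<open>The linear term in \<open>t\<close> of \<open>det (H + t K) = 0\<close> is the trace of \<open>adj H * K\<close>, and \<open>adj H\<close> has rank
  at most one because \<open>det H = 0\<close>.\<close>

lemma adjugate_isotropic:
  fixes h11 h12 h13 h22 h23 h33 k11 k12 k13 k22 k23 k33 u1 u2 u3 :: complex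
  assumes det: "\<And>t. (h11 + t * k11) * (h22 + t * k22) * (h33 + t * k33)
      + 2 * (h12 + t * k12) * (h13 + t * k13) * (h23 + t * k23)
      - (h11 + t * k11) * (h23 + t * k23)\<^sup>2
      - (h22 + t * k22) * (h13 + t * k13)\<^sup>2
      - (h33 + t * k33) * (h12 + t * k12)\<^sup>2 = 0"
  defines "a11 \<equiv> h22 * h33 - h23\<^sup>2" and "a22 \<equiv> h11 * h33 - h13\<^sup>2" and "a33 \<equiv> h11 * h22 - h12\<^sup>2"
    and "a12 \<equiv> h13 * h23 - h12 * h33" and "a13 \<equiv> h12 * h23 - h13 * h22" and "a23 \<equiv> h12 * h13 - h11 * h23"
  defines "w1 \<equiv> a11 * u1 + a12 * u2 + a13 * u3" and "w2 \<equiv> a12 * u1 + a22 * u2 + a23 * u3"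
    and "w3 \<equiv> a13 * u1 + a23 * u2 + a33 * u3"
  shows "k11 * w1\<^sup>2 + k22 * w2\<^sup>2 + k33 * w3\<^sup>2 + 2 * (k12 * w1 * w2 + k13 * w1 * w3 + k23 * w2 * w3) = 0"
proof -
  have d0: "h11 * h22 * h33 + 2 * h12 * h13 * h23 - h11 * h23\<^sup>2 - h22 * h13\<^sup>2 - h33 * h12\<^sup>2 = 0"
    using det[of 0] by simp
  define p2 where "p2 = h11 * (k22 * k33 - k23\<^sup>2) + h22 * (k11 * k33 - k13\<^sup>2) + h33 * (k11 * k22 - k12\<^sup>2)
     + 2 * h12 * (k13 * k23 - k12 * k33) + 2 * h13 * (k12 * k23 - k13 * k22) + 2 * h23 * (k12 * k13 - k11 * k23)"
  define p3 where "p3 = k11 * k22 * k33 + 2 * k12 * k13 * k23 - k11 * k23\<^sup>2 - k22 * k13\<^sup>2 - k33 * k12\<^sup>2"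
  define p1 where "p1 = a11 * k11 + a22 * k22 + a33 * k33 + 2 * (a12 * k12 + a13 * k13 + a23 * k23)"
  have p: "t * p1 + t\<^sup>2 * p2 + t ^ 3 * p3 = 0" for t
    using det[of t] d0 unfolding p1_def p2_def p3_def a11_def a22_def a33_def a12_def a13_def a23_def
    by algebra
  \<comment> \<open>Three nonzero values of \<open>t\<close> suffice to isolate the linear
    coefficient of a cubic without constant term.\<close>
  have "p1 + p2 + p3 = 0" "- p1 + p2 - p3 = 0" "2 * p1 + 4 * p2 + 8 * p3 = 0"
    using p[of 1] p[of "-1"] p[of 2] by simp_all
  then have p1: "p1 = 0"
    by algebra
  \<comment> \<open>The 2x2 minors of adj H are the entries of adj(adj H) = det H * H up to sign,
    hence zero.\<close>
  have r: "a11 * a22 = a12\<^sup>2" "a11 * a33 = a13\<^sup>2" "a22 * a33 = a23\<^sup>2"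
    "a11 * a23 = a12 * a13" "a22 * a13 = a12 * a23" "a33 * a12 = a13 * a23"
    using d0 unfolding a11_def a22_def a33_def a12_def a13_def a23_def by algebra+
  \<comment> \<open>This is u^T adj(H) u. Rank at most one gives w w^T = \<theta> adj(H), so K(w, w)
    is \<theta> times the trace \<open>p1\<close>.\<close>
  define \<theta> where "\<theta> = a11 * u1\<^sup>2 + a22 * u2\<^sup>2 + a33 * u3\<^sup>2 + 2 * (a12 * u1 * u2 + a13 * u1 * u3 + a23 * u2 * u3)"
  have "w1\<^sup>2 = \<theta> * a11" "w2\<^sup>2 = \<theta> * a22" "w3\<^sup>2 = \<theta> * a33"
    "w1 * w2 = \<theta> * a12" "w1 * w3 = \<theta> * a13" "w2 * w3 = \<theta> * a23"
    using r unfolding w1_def w2_def w3_def \<theta>_def by algebra+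
  then show ?thesis
    using p1 unfolding p1_def by algebra
qed

text \<open>For symmetric \<open>A\<close> this is u^T adj(A) u, written with the entries on and
  above the diagonal. A general ring allows both numbers and polynomials as entries.\<close>

definition adjugate_form :: "(3 \<Rightarrow> 3 \<Rightarrow> 'a::comm_ring_1) \<Rightarrow> (3 \<Rightarrow> 'a) \<Rightarrow> 'a" where
  "adjugate_form A u =
     (A 2 2 * A 3 3 - (A 2 3)\<^sup>2) * (u 1)\<^sup>2 + (A 1 1 * A 3 3 - (A 1 3)\<^sup>2) * (u 2)\<^sup>2
     + (A 1 1 * A 2 2 - (A 1 2)\<^sup>2) * (u 3)\<^sup>2
     + 2 * ((A 1 3 * A 2 3 - A 1 2 * A 3 3) * u 1 * u 2 + (A 1 2 * A 2 3 - A 1 3 * A 2 2) * u 1 * u 3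
       + (A 1 2 * A 1 3 - A 1 1 * A 2 3) * u 2 * u 3)"

text \<open>The conclusion says that \<open>w\<close> is a singular point of the cubic. The witness
  is w = adj(H(x)) u, nonzero because its product with \<open>u\<close> is the given nonzero value;
  the determinant of the Hessian vanishes on the whole line x + t z, so
  \<open>adjugate_isotropic\<close> applies.\<close>

lemma isotropic_vector:
  assumes sym: "symmetric3 T" and det: "\<And>v. det (contract T v) = 0"
    and u: "adjugate_form (\<lambda>i j. contract T x $ i $ j) (($) u) \<noteq> 0"
  obtains w where "w \<noteq> 0" "\<And>z. trilinear T w w z = 0"
proof -
  let ?H = "contract T x"
  define w where "w = (vector
    [(?H$2$2 * ?H$3$3 - (?H$2$3)\<^sup>2) * u$1 + (?H$1$3 * ?H$2$3 - ?H$1$2 * ?H$3$3) * u$2 + (?H$1$2 * ?H$2$3 - ?H$1$3 * ?H$2$2) * u$3,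
     (?H$1$3 * ?H$2$3 - ?H$1$2 * ?H$3$3) * u$1 + (?H$1$1 * ?H$3$3 - (?H$1$3)\<^sup>2) * u$2 + (?H$1$2 * ?H$1$3 - ?H$1$1 * ?H$2$3) * u$3,
     (?H$1$2 * ?H$2$3 - ?H$1$3 * ?H$2$2) * u$1 + (?H$1$2 * ?H$1$3 - ?H$1$1 * ?H$2$3) * u$2 + (?H$1$1 * ?H$2$2 - (?H$1$2)\<^sup>2) * u$3] :: complex^3)"
  have "adjugate_form (\<lambda>i j. ?H $ i $ j) (($) u) = u$1 * w$1 + u$2 * w$2 + u$3 * w$3"
    by (simp add: adjugate_form_def w_def power2_eq_square algebra_simps)
  then have "w \<noteq> 0"
    using u by auto
  moreover have "trilinear T w w z = 0" for z
  proof -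
    let ?K = "contract T z"
    have H: "?H$2$1 = ?H$1$2" "?H$3$1 = ?H$1$3" "?H$3$2 = ?H$2$3" and K: "?K$2$1 = ?K$1$2" "?K$3$1 = ?K$1$3" "?K$3$2 = ?K$2$3"
      by (simp_all add: contract_sym[OF sym])
    have "(?H$1$1 + t * ?K$1$1) * (?H$2$2 + t * ?K$2$2) * (?H$3$3 + t * ?K$3$3)
      + 2 * (?H$1$2 + t * ?K$1$2) * (?H$1$3 + t * ?K$1$3) * (?H$2$3 + t * ?K$2$3)
      - (?H$1$1 + t * ?K$1$1) * (?H$2$3 + t * ?K$2$3)\<^sup>2
      - (?H$2$2 + t * ?K$2$2) * (?H$1$3 + t * ?K$1$3)\<^sup>2
      - (?H$3$3 + t * ?K$3$3) * (?H$1$2 + t * ?K$1$2)\<^sup>2 = 0" for t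
      using det[of "x + t *s z"]
      unfolding det_3 contract_add_scale H K by algebra
    from adjugate_isotropic[OF this, of "u$1" "u$2" "u$3"]
    show ?thesis
      unfolding trilinear_contract sum_3 K by (simp add: w_def) algebra
  qed
  ultimately show ?thesis
    by (rule that)
qed

lemma basis_extension:
  assumes "w \<noteq> 0"
  obtains q r where "det3 w q r \<noteq> 0"
proof -
  have "w$1 \<noteq> 0 \<or> w$2 \<noteq> 0 \<or> w$3 \<noteq> 0"
    using assms by (auto simp: vec_eq_iff forall_3)
  then consider "det3 w (vector [0,1,0]) (vector [0,0,1]) \<noteq> 0" | "det3 w (vector [1,0,0]) (vector [0,0,1]) \<noteq> 0"
    | "det3 w (vector [1,0,0]) (vector [0,1,0]) \<noteq> 0"
    by (auto simp: det3_eq)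
  then show ?thesis
    by cases (use that in blast)+
qed

text \<open>Cramer's rule: each coordinate of \<open>v\<close> is a quotient of determinants, and
  its numerator is linear in \<open>v\<close>.\<close>

lemma basis_coordinates:
  assumes "det3 w q r \<noteq> 0"
  obtains \<rho> \<sigma> \<tau> where "\<And>v. v = dot \<rho> v *s w + dot \<sigma> v *s q + dot \<tau> v *s r"
proof
  let ?D = "det3 w q r"
  define e where "e = (\<lambda>i. axis i (1::complex) :: complex^3)"
  fix v
  have e: "e i $ j = (if i = j then 1 else 0)" for i j
    by (auto simp: e_def axis_def)
  have d: "dot (\<chi> i. det3 (e i) q r / ?D) v = det3 v q r / ?D"
    "dot (\<chi> i. det3 w (e i) r / ?D) v = det3 w v r / ?D"
    "dot (\<chi> i. det3 w q (e i) / ?D) v = det3 w q v / ?D"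
  proof -
    have "det3 v q r = (\<Sum>i\<in>UNIV. det3 (e i) q r * v $ i)"
      "det3 w v r = (\<Sum>i\<in>UNIV. det3 w (e i) r * v $ i)"
      "det3 w q v = (\<Sum>i\<in>UNIV. det3 w q (e i) * v $ i)"
      unfolding sum_3 det3_eq e by (simp_all add: algebra_simps)
    then show "dot (\<chi> i. det3 (e i) q r / ?D) v = det3 v q r / ?D"
      "dot (\<chi> i. det3 w (e i) r / ?D) v = det3 w v r / ?D"
      "dot (\<chi> i. det3 w q (e i) / ?D) v = det3 w q v / ?D"
      by (simp_all add: dot_def sum_divide_distrib)
  qed
  have "?D * v $ i = det3 v q r * w $ i + det3 w v r * q $ i + det3 w q v * r $ i" for i
    using exhaust_3[of i] by (auto simp: det3_eq algebra_simps)
  then have "v $ i = det3 v q r / ?D * w $ i + det3 w v r / ?D * q $ i + det3 w q v / ?D * r $ i" for i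
    using assms by (simp add: field_simps)
  then show "v = dot (\<chi> i. det3 (e i) q r / ?D) v *s w + dot (\<chi> i. det3 w (e i) r / ?D) v *s q + dot (\<chi> i. det3 w q (e i) / ?D) v *s r"
    unfolding d by (simp add: vec_eq_iff)
qed

text \<open>With a singular point \<open>w\<close> as first basis vector, the cubic is 3 x Q(y, z) +
  C(y, z), where x, y, z are the coordinates. If Q = 0, it depends on y and z only. Otherwise the
  Gram determinant forces it to be y^2 times a linear form.\<close>

lemma cubic_is_binary:
  assumes sym: "symmetric3 T" and det: "\<And>v. det (contract T v) = 0"
    and u: "adjugate_form (\<lambda>i j. contract T x $ i $ j) (($) u) \<noteq> 0"
  obtains \<sigma> \<tau> c0 c1 c2 c3 where
    "\<And>v. trilinear T v v v = c0 * dot \<sigma> v ^ 3 + c1 * (dot \<sigma> v)\<^sup>2 * dot \<tau> v + c2 * dot \<sigma> v * (dot \<tau> v)\<^sup>2 + c3 * dot \<tau> v ^ 3"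
proof -
  let ?B = "trilinear T"
  obtain w where w: "w \<noteq> 0" and ww: "\<And>z. ?B w w z = 0"
    using isotropic_vector[OF assms] by blast
  obtain q r where qr: "det3 w q r \<noteq> 0"
    using basis_extension[OF w] by blast
  have sw: "?B x y z = ?B y x z" "?B x y z = ?B x z y" for x y z
    by (rule trilinear_sym[OF sym])+
  have ww': "?B w z w = 0" "?B z w w = 0" for z
    using ww sw by metis+
  have sort2: "?B y x y = ?B x y y" "?B y y x = ?B x y y" for x y
    using sw by metis+
  have sort3: "?B q w r = ?B w q r" "?B w r q = ?B w q r" "?B q r w = ?B w q r" "?B r w q = ?B w q r" "?B r q w = ?B w q r" for q r
    using sw by metis+
  have sort': "?B q r q = ?B q q r" "?B r q q = ?B q q r" for q r
    using sw by metis+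
  have exp: "?B v v v = 3 * x * (y\<^sup>2 * ?B w q q + 2 * y * z * ?B w q r + z\<^sup>2 * ?B w r r)
     + y ^ 3 * ?B q q q + 3 * y\<^sup>2 * z * ?B q q r + 3 * y * z\<^sup>2 * ?B q r r + z ^ 3 * ?B r r r"
    if "v = x *s w + y *s q + z *s r" for v x y z q r
    by (simp add: that trilinear_add trilinear_scale ww ww' sort2[where x = w and y = q] sort2[where x = w and y = r] sort2[where x = q and y = r] sort'[where q = q and r = r] sort3[where q = q and r = r])
      algebra
  show ?thesis
  proof (cases "?B w q q = 0 \<and> ?B w q r = 0 \<and> ?B w r r = 0")
    case True
    obtain \<rho> \<sigma> \<tau> where *: "\<And>v. v = dot \<rho> v *s w + dot \<sigma> v *s q + dot \<tau> v *s r"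
      using basis_coordinates[OF qr] by blast
    show ?thesis
      by (rule that[of "?B q q q" \<sigma> "3 * ?B q q r" \<tau> "3 * ?B q r r" "?B r r r"])
        (subst exp[OF *], simp add: True)
  next
    case False
    \<comment> \<open>A nonzero quadratic form in two variables is nonzero at \<open>q\<close>,
      \<open>r\<close> or \<open>q + r\<close>.\<close>
    have "\<exists>q r. det3 w q r \<noteq> 0 \<and> ?B w q q \<noteq> 0"
    proof (cases "?B w q q = 0 \<and> ?B w r r = 0")
      case True
      then have "?B w (q + r) (q + r) \<noteq> 0"
        using False by (simp add: trilinear_add sort3[where q = q and r = r])
      moreover have "det3 w (q + r) r \<noteq> 0"
        using qr by (simp add: det3_eq algebra_simps)
      ultimately show ?thesis
        by blast
    next
      case F: False
      have "det3 w r q = - det3 w q r"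
        by (simp add: det3_eq algebra_simps)
      then have "det3 w r q \<noteq> 0"
        using qr by simp
      then show ?thesis
        using F qr by blast
    qed
    then obtain q r where qr: "det3 w q r \<noteq> 0" and a: "?B w q q \<noteq> 0"
      by blast
    \<comment> \<open>Orthogonalization: the multiple of \<open>q\<close> is chosen to give
      \<open>trilinear T w q s = 0\<close>.\<close>
    define s where "s = r + (- (?B w q r / ?B w q q)) *s q"
    have qs: "det3 w q s \<noteq> 0"
      using qr by (simp add: s_def det3_eq algebra_simps)
    have b: "?B w q s = 0"
      using a by (simp only: s_def trilinear_add trilinear_scale) simp
    \<comment> \<open>This is \<open>gram_det\<close> for the vectors \<open>w\<close>,
      \<open>q\<close>, \<open>s\<close> at a general point; the diagonal entry at \<open>w\<close>
      is zero because \<open>w\<close> is singular.\<close>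
    have gram: "2 * (y * ?B w q q) * (z * ?B w s s) * (y * ?B q q s + z * ?B q s s) =
       (x * ?B w q q + y * ?B q q q + z * ?B q q s) * (z * ?B w s s)\<^sup>2
      + (x * ?B w s s + y * ?B q s s + z * ?B s s s) * (y * ?B w q q)\<^sup>2" for x y z
    proof -
      let ?v = "x *s w + y *s q + z *s s"
      have "?B ?v w w = 0" "?B ?v w q = y * ?B w q q" "?B ?v w s = z * ?B w s s"
        "?B ?v q q = x * ?B w q q + y * ?B q q q + z * ?B q q s"
        "?B ?v q s = y * ?B q q s + z * ?B q s s"
        "?B ?v s s = x * ?B w s s + y * ?B q s s + z * ?B s s s"
        by (simp_all add: trilinear_add trilinear_scale ww ww' b sort2[where x = w and y = q] sort2[where x = w and y = s] sort2[where x = q and y = s] sort'[where q = q and r = s] sort3[where q = q and r = s])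
      with gram_det[OF sym det, of ?v w q s] show ?thesis
        by simp
    qed
    have c: "?B w s s = 0" and d: "?B q s s = 0"
      using gram[where x = 1 and y = 1 and z = 0] gram[where x = 0 and y = 1 and z = 0] a by simp_all
    have e: "?B s s s = 0"
      using gram[where x = 0 and y = 1 and z = 1] a c d by simp
    obtain \<rho> \<sigma> \<tau> where *: "\<And>v. v = dot \<rho> v *s w + dot \<sigma> v *s q + dot \<tau> v *s s"
      using basis_coordinates[OF qs] by blast
    \<comment> \<open>What remains is \<open>\<sigma>\<^sup>2 (B q q q \<sigma> + \<mu>)\<close>
      with B = \<open>trilinear T\<close>, a binary cubic in \<sigma> and \<mu>.\<close>
    define \<mu> where "\<mu> = (3 * ?B w q q) *s \<rho> + (3 * ?B q q s) *s \<tau>"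
    have \<mu>: "dot \<mu> v = 3 * ?B w q q * dot \<rho> v + 3 * ?B q q s * dot \<tau> v" for v
      by (simp add: \<mu>_def dot_def sum_3 algebra_simps)
    show ?thesis
      by (rule that[of "?B q q q" \<sigma> 1 \<mu> 0 0])
        (subst exp[OF *], simp add: \<mu> b c d e, algebra)
  qed
qed

text \<open>A root of the dehomogenized cubic (t = 1) splits off a linear factor, and the quadratic
  formula factors the rest. If \<open>c0 = 0\<close>, then \<open>t\<close> itself is a
  factor.\<close>

lemma binary_cubic_factors:
  fixes c0 c1 c2 c3 :: complex
  obtains a1 a2 b1 b2 d1 d2 where
    "\<And>s t. c0 * s ^ 3 + c1 * s\<^sup>2 * t + c2 * s * t\<^sup>2 + c3 * t ^ 3 = (a1 * s + a2 * t) * (b1 * s + b2 * t) * (d1 * s + d2 * t)"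
proof -
  have quadratic: "\<exists>b1 b2 d1 d2. \<forall>s t. e0 * s\<^sup>2 + e1 * s * t + e2 * t\<^sup>2 = (b1 * s + b2 * t) * (d1 * s + d2 * t)"
    for e0 e1 e2 :: complex
  proof (cases "e0 = 0")
    case True
    have "\<forall>s t. e0 * s\<^sup>2 + e1 * s * t + e2 * t\<^sup>2 = (0 * s + 1 * t) * (e1 * s + e2 * t)"
      by (simp add: True power2_eq_square algebra_simps)
    then show ?thesis
      by blast
  next
    case False
    define r where "r = csqrt (e1\<^sup>2 - 4 * e0 * e2)"
    have r: "r\<^sup>2 = e1\<^sup>2 - 4 * e0 * e2"
      by (simp add: r_def)
    have "e0 * s\<^sup>2 + e1 * s * t + e2 * t\<^sup>2 = (e0 * s + (e1 - r) / 2 * t) * (1 * s + (e1 + r) / (2 * e0) * t)" for s t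
    proof -
      have "4 * e0 * (e0 * s\<^sup>2 + e1 * s * t + e2 * t\<^sup>2) = (2 * e0 * s + (e1 - r) * t) * (2 * e0 * s + (e1 + r) * t)"
        using r by algebra
      then show ?thesis
        using False by (simp add: field_simps)
    qed
    then show ?thesis
      by blast
  qed
  show ?thesis
  proof (cases "c0 = 0")
    case True
    obtain b1 b2 d1 d2 where *: "\<And>s t. c1 * s\<^sup>2 + c2 * s * t + c3 * t\<^sup>2 = (b1 * s + b2 * t) * (d1 * s + d2 * t)"
      using quadratic[of c1 c2 c3] by blast
    show ?thesis
    proof (rule that[of 0 1 b1 b2 d1 d2])
      show "c0 * s ^ 3 + c1 * s\<^sup>2 * t + c2 * s * t\<^sup>2 + c3 * t ^ 3 = (0 * s + 1 * t) * (b1 * s + b2 * t) * (d1 * s + d2 * t)" for s t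
        using *[of s t] True by algebra
    qed
  next
    case False
    have "degree [:c3, c2, c1, c0:] > 0"
      using False by simp
    then obtain z where "poly [:c3, c2, c1, c0:] z = 0"
      using alg_closed_imp_poly_has_root by blast
    then have z: "c3 = - (c2 * z + c1 * z\<^sup>2 + c0 * z ^ 3)"
      by (simp add: algebra_simps power2_eq_square power3_eq_cube eq_neg_iff_add_eq_0)
    \<comment> \<open>The coefficients of the quotient by s - z t come from synthetic
      division.\<close>
    obtain b1 b2 d1 d2 where *: "\<And>s t. c0 * s\<^sup>2 + (c1 + c0 * z) * s * t + (c2 + c1 * z + c0 * z\<^sup>2) * t\<^sup>2 = (b1 * s + b2 * t) * (d1 * s + d2 * t)"
      using quadratic by blast
    show ?thesis
    proof (rule that[of 1 "- z" b1 b2 d1 d2])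
      show "c0 * s ^ 3 + c1 * s\<^sup>2 * t + c2 * s * t\<^sup>2 + c3 * t ^ 3 = (1 * s + - z * t) * (b1 * s + b2 * t) * (d1 * s + d2 * t)" for s t
        using *[of s t] z by algebra
    qed
  qed
qed

section \<open>Concomitants as determinants and adjugates\<close>

lemma eval_uminus: "eval \<sigma> (- p) = - eval \<sigma> p"
  using id.insertion_add[of \<sigma> p "- p"] by (simp add: eq_neg_iff_add_eq_0 add.commute id.insertion_0)

lemma eval_diff: "eval \<sigma> (p - q) = eval \<sigma> p - eval \<sigma> q"
  using id.insertion_add[of \<sigma> p "- q"] by (simp add: eval_uminus)

lemma eval_scale: "eval \<sigma> (scale c p) = c * eval \<sigma> p"
  by (simp add: scale_def eval_simps)

lemma pd_commute: "pd v (pd w p) = pd w (pd v p)"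
proof (induction p rule: poly_mapping_single_induct)
  case (single m c)
  have "m - Poly_Mapping.single w 1 - Poly_Mapping.single v 1 = m - Poly_Mapping.single v 1 - Poly_Mapping.single w (1 :: nat)"
    by (rule poly_mapping_eqI) (simp add: lookup_minus)
  then show ?case
    by (simp add: pd_single lookup_minus lookup_single when_def mult.left_commute)
qed (simp add: pd_add)

lemma mixed_det_eq:
  "mixed_det a b c =
    (a 1 1 * b 2 2 * c 3 3 + a 1 2 * b 2 3 * c 3 1 + a 1 3 * b 2 1 * c 3 2
      - a 1 1 * b 2 3 * c 3 2 - a 1 2 * b 2 1 * c 3 3 - a 1 3 * b 2 2 * c 3 1)
  + (a 2 1 * b 3 2 * c 1 3 + a 2 2 * b 3 3 * c 1 1 + a 2 3 * b 3 1 * c 1 2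
      - a 2 1 * b 3 3 * c 1 2 - a 2 2 * b 3 1 * c 1 3 - a 2 3 * b 3 2 * c 1 1)
  + (a 3 1 * b 1 2 * c 2 3 + a 3 2 * b 1 3 * c 2 1 + a 3 3 * b 1 1 * c 2 2
      - a 3 1 * b 1 3 * c 2 2 - a 3 2 * b 1 1 * c 2 3 - a 3 3 * b 1 2 * c 2 1)
  - (a 1 1 * b 3 2 * c 2 3 + a 1 2 * b 3 3 * c 2 1 + a 1 3 * b 3 1 * c 2 2
      - a 1 1 * b 3 3 * c 2 2 - a 1 2 * b 3 1 * c 2 3 - a 1 3 * b 3 2 * c 2 1)
  - (a 2 1 * b 1 2 * c 3 3 + a 2 2 * b 1 3 * c 3 1 + a 2 3 * b 1 1 * c 3 2
      - a 2 1 * b 1 3 * c 3 2 - a 2 2 * b 1 1 * c 3 3 - a 2 3 * b 1 2 * c 3 1)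
  - (a 3 1 * b 2 2 * c 1 3 + a 3 2 * b 2 3 * c 1 1 + a 3 3 * b 2 1 * c 1 2
      - a 3 1 * b 2 3 * c 1 2 - a 3 2 * b 2 1 * c 1 3 - a 3 3 * b 2 2 * c 1 1)"
proof -
  define I where "I s i j k = (\<Sum>q | q permutes (UNIV :: 3 set).
    of_int s * of_int (sign q) * (a i (q 1) * b j (q 2) * c k (q 3)))" for s i j k
  have I: "I s i j k = of_int s *
     (a i 1 * b j 2 * c k 3 + a i 2 * b j 3 * c k 1 + a i 3 * b j 1 * c k 2
      - a i 1 * b j 3 * c k 2 - a i 2 * b j 1 * c k 3 - a i 3 * b j 2 * c k 1)" for s i j k
    unfolding I_def
    by (subst sum_permutes_3[of "\<lambda>t q1 q2 q3. of_int s * of_int t * (a i q1 * b j q2 * c k q3)"])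
      (simp add: algebra_simps)
  have "mixed_det a b c = (\<Sum>p | p permutes (UNIV :: 3 set). I (sign p) (p 1) (p 2) (p 3))"
    by (simp add: mixed_det_def I_def)
  also have "\<dots> = I 1 1 2 3 + I 1 2 3 1 + I 1 3 1 2 + I (- 1) 1 3 2 + I (- 1) 2 1 3 + I (- 1) 3 2 1"
    by (rule sum_permutes_3)
  finally show ?thesis
    by (simp add: I)
qed

lemma mixed_det_self:
  "mixed_det a a a = 6 * det (\<chi> i j. a i j)"
  unfolding mixed_det_eq det_3 by (simp add: algebra_simps)

text \<open>In general \<open>mixed_det a a c\<close> is twice the trace of adj(a) c, as the
  derivative of the determinant shows. The matrix used for \<open>c\<close> here is the Hessian of
  \<open>u_x\<^sup>2\<close>.\<close>

lemma mixed_det_adjugate: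
  assumes "\<And>i j. a i j = a j i"
  shows "mixed_det a a (\<lambda>i j. 2 * u i * u j) = 4 * adjugate_form a u"
proof -
  have s: "a 2 1 = a 1 2" "a 3 1 = a 1 3" "a 3 2 = a 2 3"
    by (rule assms)+
  show ?thesis
    unfolding mixed_det_eq adjugate_form_def s by (simp add: algebra_simps power2_eq_square)
qed

text \<open>The determinant with rows \<open>u\<close>, \<open>p\<close>, \<open>q\<close>.\<close>

definition triple_prod :: "(3 \<Rightarrow> 'a::comm_ring_1) \<Rightarrow> (3 \<Rightarrow> 'a) \<Rightarrow> (3 \<Rightarrow> 'a) \<Rightarrow> 'a" where
  "triple_prod u p q = u 1 * (p 2 * q 3 - p 3 * q 2) + u 2 * (p 3 * q 1 - p 1 * q 3) + u 3 * (p 1 * q 2 - p 2 * q 1)"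

text \<open>The adjugate of such a matrix is (c g - e^2) n n^T, where n is the cross product of
  \<open>p\<close> and \<open>q\<close>.\<close>

lemma adjugate_form_rank_2:
  "adjugate_form (\<lambda>i j. c * p i * p j + e * (p i * q j + q i * p j) + g * q i * q j) u =
    (c * g - e\<^sup>2) * (triple_prod u p q)\<^sup>2"
  unfolding adjugate_form_def triple_prod_def by (simp add: algebra_simps power2_eq_square)

lemma det_rank_2:
  fixes p q :: "3 \<Rightarrow> 'a::comm_ring_1"
  shows "det (\<chi> i j. c * p i * p j + g * q i * q j) = 0"
  unfolding det_3 by (simp add: algebra_simps)

lemma pd_u_x: "pd (X j) (pd (X i) (u_x\<^sup>2)) = 2 * Var (U i) * Var (U j)"
proof -
  have "pd (X i) u_x = Var (U i)" for i
    by (simp add: u_x_def pd_sum pd_mult pd_Var if_distrib cong: if_cong)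
  moreover have "pd (X j) (Var (U i)) = 0"
    by (simp add: pd_Var)
  ultimately show ?thesis
    by (simp add: pd_power2 pd_mult mult_ac)
qed

lemma u_x_in: "u_x\<^sup>2 \<in> polys_XU"
  unfolding u_x_def by (intro polys_in_power polys_in_sum polys_in.mult polys_in.Var) auto

abbreviation "hess p i j \<equiv> pd (X j) (pd (X i) p)"

lemma Delta_eq:
  assumes "f \<in> polys_XU"
  shows "Delta_xxx f = scale (1/2) (det (\<chi> i j. hess f i j))"
proof -
  have "Delta_xxx f = Const (1/12) * (Const 6 * det (\<chi> i j. hess f i j))"
    by (simp add: Delta_xxx_def scale_def transvectant_2[OF assms assms assms] mixed_det_self)
  also have "\<dots> = Const (1/12 * 6) * det (\<chi> i j. hess f i j)"
    by (simp only: Const_mult mult.assoc)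
  finally show ?thesis
    by (simp add: scale_def)
qed

lemma theta_eq:
  assumes "f \<in> polys_XU"
  shows "theta_uuxx f = adjugate_form (hess f) (\<lambda>i. Var (U i))"
proof -
  have "theta_uuxx f = Const (1/4) * (Const 4 * adjugate_form (hess f) (\<lambda>i. Var (U i)))"
    unfolding theta_uuxx_def scale_def transvectant_2[OF assms assms u_x_in] pd_u_x
    by (subst mixed_det_adjugate) (simp_all add: pd_commute)
  also have "\<dots> = Const (1/4 * 4) * adjugate_form (hess f) (\<lambda>i. Var (U i))"
    by (simp only: Const_mult mult.assoc)
  finally show ?thesis
    by simp
qed

lemma F_eq:
  assumes "theta_uuxx f \<in> polys_XU"
  shows "F_6u f = scale (1/768) (adjugate_form (hess (theta_uuxx f)) (\<lambda>i. Var (U i)))"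
proof -
  let ?\<theta> = "theta_uuxx f"
  have "F_6u f = Const (1/3072) * (Const 4 * adjugate_form (hess ?\<theta>) (\<lambda>i. Var (U i)))"
    unfolding F_6u_def scale_def transvectant_2[OF assms assms u_x_in] pd_u_x
    by (subst mixed_det_adjugate) (simp_all add: pd_commute)
  also have "\<dots> = Const (1/3072 * 4) * adjugate_form (hess ?\<theta>) (\<lambda>i. Var (U i))"
    by (simp only: Const_mult mult.assoc)
  finally show ?thesis
    by (simp add: scale_def)
qed

section \<open>Linear and cubic forms\<close>

definition lin :: "complex^3 \<Rightarrow> mpoly" where
  "lin \<alpha> = (\<Sum>i\<in>UNIV. Const (\<alpha> $ i) * Var (X i))"

definition cubic :: "(3 \<Rightarrow> 3 \<Rightarrow> 3 \<Rightarrow> complex) \<Rightarrow> mpoly" where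
  "cubic T = (\<Sum>i\<in>UNIV. \<Sum>j\<in>UNIV. \<Sum>k\<in>UNIV. Const (T i j k) * Var (X i) * Var (X j) * Var (X k))"

lemma lin_in [intro]: "lin \<alpha> \<in> polys_XU"
  unfolding lin_def by (intro polys_in_sum polys_in.mult) auto

lemma cubic_in: "cubic T \<in> polys_XU"
  unfolding cubic_def by (intro polys_in_sum polys_in.mult) auto

lemma pd_lin: "pd (X i) (lin \<alpha>) = Const (\<alpha> $ i)"
  by (simp add: lin_def pd_sum pd_mult pd_Var if_distrib cong: if_cong)

lemma eval_lin: "eval \<sigma> (lin \<alpha>) = dot \<alpha> (\<chi> i. \<sigma> (X i))"
  by (simp add: lin_def dot_def eval_simps)

lemma eval_cubic: "eval \<sigma> (cubic T) = trilinear T (\<chi> i. \<sigma> (X i)) (\<chi> i. \<sigma> (X i)) (\<chi> i. \<sigma> (X i))"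
  by (simp add: cubic_def trilinear_def eval_simps)

lemma lin_combination: "lin (c *s \<alpha> + d *s \<beta>) = scale c (lin \<alpha>) + scale d (lin \<beta>)"
  by (simp add: lin_def scale_def sum_distrib_left sum.distrib Const_add Const_mult algebra_simps)

lemma lin_add: "lin (\<alpha> + \<beta>) = lin \<alpha> + lin \<beta>"
  using lin_combination[of 1 \<alpha> 1 \<beta>] by simp

lemma lin_scale: "lin (c *s \<alpha>) = scale c (lin \<alpha>)"
  using lin_combination[of c \<alpha> 0 0] by simp

lemma eval_hess_cubic:
  assumes "symmetric3 T"
  shows "eval \<sigma> (hess (cubic T) i j) = 6 * contract T (\<chi> i. \<sigma> (X i)) $ i $ j"
proof -
  \<comment> \<open>Naming the Kronecker delta keeps the product rule uniform in \<open>i\<close>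
    and \<open>j\<close>; the nine index cases are split only after evaluation.\<close>
  define \<delta> where "\<delta> a i = Const (if a = i then 1 else 0)" for a i :: 3
  let ?x = "\<lambda>i. Var (X i)"
  have d: "pd (X i) (?x a) = \<delta> a i" "pd (X i) (\<delta> a j) = 0" for i j a
    by (auto simp: pd_Var \<delta>_def)
  have "hess (Const c * ?x a * ?x b * ?x k) i j = Const c *
      (\<delta> a i * \<delta> b j * ?x k + \<delta> a i * \<delta> k j * ?x b + \<delta> b i * \<delta> a j * ?x k
       + \<delta> b i * \<delta> k j * ?x a + \<delta> k i * \<delta> a j * ?x b + \<delta> k i * \<delta> b j * ?x a)" for a b k c
    by (simp add: pd_mult pd_add d algebra_simps)
  then have h: "hess (cubic T) i j = (\<Sum>a\<in>UNIV. \<Sum>b\<in>UNIV. \<Sum>k\<in>UNIV. Const (T a b k) *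
      (\<delta> a i * \<delta> b j * ?x k + \<delta> a i * \<delta> k j * ?x b + \<delta> b i * \<delta> a j * ?x k
       + \<delta> b i * \<delta> k j * ?x a + \<delta> k i * \<delta> a j * ?x b + \<delta> k i * \<delta> b j * ?x a))"
    by (simp add: cubic_def pd_sum)
  have e: "eval \<sigma> (\<delta> a i) = (if a = i then 1 else 0)" for a i
    by (simp add: \<delta>_def eval_simps)
  show ?thesis
    unfolding h eval_simps e contract_def sum_3
    using exhaust_3[of i] exhaust_3[of j]
    by (elim disjE) (simp_all add: symmetric3_sorted[OF assms] algebra_simps)
qed

section \<open>Homogeneous forms as coefficient arrays\<close>

lemma is_form_add: "is_form d p \<Longrightarrow> is_form d q \<Longrightarrow> is_form d (p + q)"
  using keys_add[of p q] unfolding is_form_def by blast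

lemma is_form_sum:
  assumes "\<And>i. i \<in> A \<Longrightarrow> is_form d (p i)"
  shows "is_form d (\<Sum>i\<in>A. p i)"
proof -
  have "is_form d 0"
    by (simp add: is_form_def)
  with assms show ?thesis
    by (induction A rule: infinite_finite_induct) (auto intro: is_form_add)
qed

lemma is_form_lin: "is_form 1 (lin \<alpha>)"
  unfolding lin_def
proof (rule is_form_sum)
  fix i
  show "is_form 1 (Const (\<alpha> $ i) * Var (X i))"
    by (auto simp: Const_def Var_def mult_single is_form_def lookup_single when_def split: if_splits)
qed

lemma form_monomial_Suc:
  fixes m :: mon
  assumes "Poly_Mapping.keys m \<subseteq> range X" "(\<Sum>i\<in>UNIV. Poly_Mapping.lookup m (X i)) = Suc d"
  obtains i n where "m = Poly_Mapping.single (X i) 1 + n" "Poly_Mapping.keys n \<subseteq> range X"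
    "(\<Sum>i\<in>UNIV. Poly_Mapping.lookup n (X i)) = d"
proof -
  obtain i where i: "Poly_Mapping.lookup m (X i) \<noteq> 0"
    using assms(2) by (metis nat.distinct(1) sum.neutral)
  define n where "n = m - Poly_Mapping.single (X i) 1"
  have m: "m = Poly_Mapping.single (X i) 1 + n"
    by (rule poly_mapping_eqI) (use i in \<open>auto simp: n_def lookup_add lookup_minus lookup_single when_def\<close>)
  show ?thesis
  proof (rule that[OF m])
    show "Poly_Mapping.keys n \<subseteq> range X"
      using assms(1) by (auto simp: n_def in_keys_iff lookup_minus subset_iff)
    have "(\<Sum>j\<in>UNIV. Poly_Mapping.lookup (Poly_Mapping.single (X i) (1::nat)) (X j)) = 1"
      by (simp add: lookup_single when_def)
    then show "(\<Sum>i\<in>UNIV. Poly_Mapping.lookup n (X i)) = d"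
      using assms(2) unfolding m by (simp add: lookup_add sum.distrib)
  qed
qed

lemma form_monomial_0:
  fixes m :: mon
  assumes "Poly_Mapping.keys m \<subseteq> range X" "(\<Sum>i\<in>UNIV. Poly_Mapping.lookup m (X i)) = 0"
  shows "m = 0"
proof (rule poly_mapping_eqI)
  fix v
  have "Poly_Mapping.lookup m (X i) = 0" for i
    using assms(2) sum_eq_0_iff[of UNIV "\<lambda>i. Poly_Mapping.lookup m (X i)"] by auto
  then show "Poly_Mapping.lookup m v = Poly_Mapping.lookup 0 v"
    using assms(1) by (cases "v \<in> range X") (auto simp: in_keys_iff)
qed

lemma is_form_induct [consumes 1, case_names zero add monomial]:
  assumes "is_form d p" "P 0" "\<And>p q. P p \<Longrightarrow> P q \<Longrightarrow> P (p + q)"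
    and "\<And>m c. Poly_Mapping.keys m \<subseteq> range X \<Longrightarrow> (\<Sum>i\<in>UNIV. Poly_Mapping.lookup m (X i)) = d \<Longrightarrow> P (Poly_Mapping.single m c)"
  shows "P p"
proof -
  have "P (\<Sum>m\<in>A. Poly_Mapping.single m (Poly_Mapping.lookup p m))" if "finite A" "A \<subseteq> Poly_Mapping.keys p" for A
    using that by induction (use assms in \<open>auto simp: is_form_def\<close>)
  from this[of "Poly_Mapping.keys p"] show ?thesis
    by (simp flip: mpoly_eq_sum_single)
qed

lemma is_form_1_iff: "is_form 1 a \<longleftrightarrow> (\<exists>\<alpha>. a = lin \<alpha>)"
proof
  assume "is_form 1 a"
  then show "\<exists>\<alpha>. a = lin \<alpha>"
  proof (induction rule: is_form_induct)
    case zero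
    show ?case
      by (rule exI[of _ 0]) (simp add: lin_def)
  next
    case (add p q)
    then show ?case
      by (metis lin_add)
  next
    case (monomial m c)
    obtain i where i: "m = Poly_Mapping.single (X i) 1"
      using form_monomial_Suc[of m 0] form_monomial_0 monomial by (metis One_nat_def add.right_neutral)
    have "lin (axis i c) = (\<Sum>j\<in>UNIV. if j = i then Const c * Var (X i) else 0)"
      unfolding lin_def by (rule sum.cong) (auto simp: axis_def)
    then show ?case
      by (intro exI[of _ "axis i c"]) (simp add: i Const_def Var_def mult_single)
  qed
qed (use is_form_lin in auto)

lemma cubic_add: "cubic (\<lambda>i j k. S i j k + T i j k) = cubic S + cubic T"
  by (simp add: cubic_def Const_add distrib_right sum.distrib)

lemma is_form_3_cubic:
  assumes "is_form 3 f"
  obtains T where "f = cubic T"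
proof -
  have "\<exists>T. f = cubic T"
    using assms
  proof (induction rule: is_form_induct)
    case zero
    show ?case
      by (rule exI[of _ "\<lambda>i j k. 0"]) (simp add: cubic_def)
  next
    case (add p q)
    then show ?case
      by (auto simp flip: cubic_add)
  next
    case (monomial m c)
    have 3: "3 = Suc 2" "2 = Suc 1" "1 = Suc 0"
      by simp_all
    obtain i n where i: "m = Poly_Mapping.single (X i) 1 + n" and n: "Poly_Mapping.keys n \<subseteq> range X"
      "(\<Sum>i\<in>UNIV. Poly_Mapping.lookup n (X i)) = 2"
      using form_monomial_Suc[of m 2] monomial 3 by metis
    obtain j l where j: "n = Poly_Mapping.single (X j) 1 + l" and l: "Poly_Mapping.keys l \<subseteq> range X"
      "(\<Sum>i\<in>UNIV. Poly_Mapping.lookup l (X i)) = 1"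
      using form_monomial_Suc[of n 1] n 3 by metis
    obtain k where k: "l = Poly_Mapping.single (X k) 1"
      using form_monomial_Suc[of l 0] form_monomial_0 l by (metis One_nat_def add.right_neutral)
    \<comment> \<open>An array with a single nonzero entry; the nested conditions let the three sums
      collapse one after the other.\<close>
    have "cubic (\<lambda>i' j' k'. if k' = k then if j' = j then if i' = i then c else 0 else 0 else 0) =
       Const c * Var (X i) * Var (X j) * Var (X k)"
      by (simp add: cubic_def if_distrib[of Const] if_distrib[of "\<lambda>x. x * _"] cong: if_cong)
    also have "\<dots> = Poly_Mapping.single m c"
      by (simp add: i j k Const_def Var_def mult_single add.assoc)
    finally show ?case
      by metis
  qed
  then show ?thesis
    using that by blast
qed

text \<open>Averaging the array over the six orders of its indices does not change the values of the
  cubic, hence not the polynomial.\<close>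

lemma is_form_3_symmetric:
  assumes "is_form 3 f"
  obtains T where "symmetric3 T" "f = cubic T"
proof -
  obtain T where T: "f = cubic T"
    using is_form_3_cubic[OF assms] .
  define S where "S i j k = (T i j k + T i k j + T j i k + T j k i + T k i j + T k j i) / 6" for i j k
  have "trilinear S v v v = trilinear T v v v" for v
    unfolding trilinear_def sum_3 S_def by (simp add: field_simps)
  then have "cubic T = cubic S"
    by (intro eval_eqI) (simp add: eval_cubic)
  moreover have "symmetric3 S"
    by (simp add: symmetric3_def S_def)
  ultimately show ?thesis
    using that T by blast
qed

section \<open>Linear independence of forms\<close>

text \<open>The coefficient criterion also accounts for distinctness: for \<open>a = b\<close> the
  coefficients 1 and -1 give a relation.\<close>

lemma lin_indep_2_iff:
  "lin_indep [a, b] \<longleftrightarrow> (\<forall>s t. scale s a + scale t b = 0 \<longrightarrow> s = 0 \<and> t = 0)" (is "_ \<longleftrightarrow> ?R")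
proof -
  have L: "lin_indep [a, b] \<longleftrightarrow> b \<noteq> 0 \<and> (\<forall>k. a \<noteq> scale k b)"
    by (auto simp: lin_indep_def mpoly.independent_insert mpoly.span_singleton) (metis mpoly.scale_one)
  show ?thesis
  proof
    assume l: "lin_indep [a, b]"
    show ?R
    proof (intro allI impI)
      fix s t assume *: "scale s a + scale t b = 0"
      have "s = 0"
      proof (rule ccontr)
        assume "s \<noteq> 0"
        have "scale s a = scale (- t) b"
          using * by (simp add: eq_neg_iff_add_eq_0)
        then have "scale (1 / s) (scale s a) = scale (1 / s) (scale (- t) b)"
          by simp
        then have "a = scale (1 / s * - t) b"
          using \<open>s \<noteq> 0\<close> by (simp only: mpoly.scale_scale) simp
        with l show False
          unfolding L by blast
      qed
      then show "s = 0 \<and> t = 0"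
        using * l by (simp add: L)
    qed
  next
    assume r: ?R
    have "b \<noteq> 0"
      using r[rule_format, of 0 1] by auto
    moreover have "a \<noteq> scale k b" for k
      using r[rule_format, of 1 "- k"] by auto
    ultimately show "lin_indep [a, b]"
      by (simp add: L)
  qed
qed

lemma not_lin_indepE:
  assumes "\<not> lin_indep [a, b]"
  obtains k where "a = scale k b" | k where "b = scale k a"
proof -
  obtain s t where st: "scale s a + scale t b = 0" "s \<noteq> 0 \<or> t \<noteq> 0"
    using assms by (auto simp: lin_indep_2_iff)
  have solve: "a = scale (- t / s) b" if "scale s a + scale t b = 0" "s \<noteq> 0" for s t and a b :: mpoly
  proof -
    have "scale s a = scale (- t) b"
      using that(1) by (simp add: eq_neg_iff_add_eq_0)
    then have "scale (1 / s) (scale s a) = scale (1 / s) (scale (- t) b)"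
      by simp
    then show ?thesis
      using that(2) by simp
  qed
  from st(2) show ?thesis
  proof
    assume "s \<noteq> 0"
    from that(1)[OF solve[OF st(1) this]] show ?thesis .
  next
    assume "t \<noteq> 0"
    from that(2)[OF solve[OF _ this, of b s a]] show ?thesis
      using st(1) by (simp add: add.commute)
  qed
qed

lemma lin_indep_transform:
  assumes "lin_indep [a, b]" "s1 * t2 - s2 * t1 \<noteq> 0"
  shows "lin_indep [scale s1 a + scale t1 b, scale s2 a + scale t2 b]"
  unfolding lin_indep_2_iff
proof (intro allI impI)
  fix x y
  assume "scale x (scale s1 a + scale t1 b) + scale y (scale s2 a + scale t2 b) = 0"
  then have "scale (x * s1 + y * s2) a + scale (x * t1 + y * t2) b = 0"
    by (simp add: mpoly.scale_right_distrib mpoly.scale_left_distrib algebra_simps)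
  then have "x * s1 + y * s2 = 0" "x * t1 + y * t2 = 0"
    using assms(1) by (auto simp: lin_indep_2_iff)
  then have "x * (s1 * t2 - s2 * t1) = 0" "y * (s1 * t2 - s2 * t1) = 0"
    by algebra+
  then show "x = 0 \<and> y = 0"
    using assms(2) by simp
qed

section \<open>Concomitants of degenerate cubics\<close>

text \<open>The Hessian matrix is a combination of \<alpha> \<alpha>^T and \<beta> \<beta>^T, so its
  rank is at most two.\<close>

lemma Delta_sum_two_cubes: "Delta_xxx (lin \<alpha> ^ 3 + lin \<beta> ^ 3) = 0"
proof -
  have h: "hess (lin \<alpha> ^ 3 + lin \<beta> ^ 3) i j =
    (6 * lin \<alpha>) * Const (\<alpha> $ i) * Const (\<alpha> $ j) + (6 * lin \<beta>) * Const (\<beta> $ i) * Const (\<beta> $ j)" for i j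
    by (simp add: power3_eq_cube pd_add pd_mult pd_lin algebra_simps)
  have "lin \<alpha> ^ 3 + lin \<beta> ^ 3 \<in> polys_XU"
    by auto
  then show ?thesis
    unfolding Delta_eq[OF \<open>_ \<in> _\<close>] h det_rank_2 by simp
qed

abbreviation "wedge \<alpha> \<beta> \<equiv> triple_prod (\<lambda>i. Var (U i)) (\<lambda>i. Const (\<alpha> $ i)) (\<lambda>i. Const (\<beta> $ i))"

lemma wedge_in: "wedge \<alpha> \<beta> \<in> polys_XU"
  unfolding triple_prod_def by (intro polys_in.add polys_in.mult polys_in_diff polys_in.Const polys_in.Var) auto

lemma pd_wedge: "pd (X i) (wedge \<alpha> \<beta>) = 0"
  by (simp add: triple_prod_def pd_add pd_mult pd_diff pd_Var)

text \<open>\<open>adjugate_form_rank_2\<close> is used twice: the first use shows that \<theta> is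
  a multiple of the product of the two linear forms, and the Hessian of this product again has the
  required shape. The constant is -36^2 / 768.\<close>

lemma F_sum_two_cubes:
  "F_6u (lin \<alpha> ^ 3 + lin \<beta> ^ 3) = scale (- 27 / 16) (wedge \<alpha> \<beta> ^ 6)"
proof -
  let ?f = "lin \<alpha> ^ 3 + lin \<beta> ^ 3" and ?D = "wedge \<alpha> \<beta>"
  \<comment> \<open>The vanishing middle term is spelled out to match the pattern of
    \<open>adjugate_form_rank_2\<close>.\<close>
  have h: "hess ?f = (\<lambda>i j. (6 * lin \<alpha>) * Const (\<alpha> $ i) * Const (\<alpha> $ j)
     + 0 * (Const (\<alpha> $ i) * Const (\<beta> $ j) + Const (\<beta> $ i) * Const (\<alpha> $ j))
     + (6 * lin \<beta>) * Const (\<beta> $ i) * Const (\<beta> $ j))"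
    by (simp add: fun_eq_iff power3_eq_cube pd_add pd_mult pd_lin algebra_simps)
  have f: "?f \<in> polys_XU"
    by auto
  have \<theta>: "theta_uuxx ?f = 36 * lin \<alpha> * lin \<beta> * ?D\<^sup>2"
    unfolding theta_eq[OF f] h adjugate_form_rank_2 by simp
  have "hess (theta_uuxx ?f) = (\<lambda>i j. 0 * Const (\<alpha> $ i) * Const (\<alpha> $ j)
     + (36 * ?D\<^sup>2) * (Const (\<alpha> $ i) * Const (\<beta> $ j) + Const (\<beta> $ i) * Const (\<alpha> $ j))
     + 0 * Const (\<beta> $ i) * Const (\<beta> $ j))"
    unfolding \<theta> by (simp add: fun_eq_iff pd_add pd_mult pd_lin pd_wedge pd_power2 algebra_simps)
  moreover have "theta_uuxx ?f \<in> polys_XU"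
    unfolding \<theta> by (intro polys_in.mult polys_in_power polys_in_numeral lin_in wedge_in)
  ultimately have "F_6u ?f = scale (1/768) (- ((36 * ?D\<^sup>2)\<^sup>2 * ?D\<^sup>2))"
    by (simp only: F_eq adjugate_form_rank_2) simp
  also have "\<dots> = scale (1/768) (Const (- 1296) * ?D ^ 6)"
    by (simp add: power_mult_distrib Const_uminus mult.assoc flip: power_mult power_add)
  also have "\<dots> = scale (- 27 / 16) (?D ^ 6)"
    by (simp add: scale_def Const_mult[symmetric] mult.assoc[symmetric])
  finally show ?thesis .
qed

text \<open>Here \<theta> is a multiple of the square of \<open>lin \<alpha>\<close>, so its Hessian
  in x has rank at most one and zero adjugate.\<close>

lemma F_square_times: "F_6u ((lin \<alpha>)\<^sup>2 * lin \<beta>) = 0"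
proof -
  let ?f = "(lin \<alpha>)\<^sup>2 * lin \<beta>" and ?D = "wedge \<alpha> \<beta>"
  have h: "hess ?f = (\<lambda>i j. (2 * lin \<beta>) * Const (\<alpha> $ i) * Const (\<alpha> $ j)
     + (2 * lin \<alpha>) * (Const (\<alpha> $ i) * Const (\<beta> $ j) + Const (\<beta> $ i) * Const (\<alpha> $ j))
     + 0 * Const (\<beta> $ i) * Const (\<beta> $ j))"
    by (simp add: fun_eq_iff power2_eq_square pd_add pd_mult pd_lin algebra_simps)
  have f: "?f \<in> polys_XU"
    by auto
  have \<theta>: "theta_uuxx ?f = - 4 * (lin \<alpha>)\<^sup>2 * ?D\<^sup>2"
    unfolding theta_eq[OF f] h adjugate_form_rank_2 by (simp add: power_mult_distrib)
  have "hess (theta_uuxx ?f) = (\<lambda>i j. (- 8 * ?D\<^sup>2) * Const (\<alpha> $ i) * Const (\<alpha> $ j)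
     + 0 * (Const (\<alpha> $ i) * Const (\<beta> $ j) + Const (\<beta> $ i) * Const (\<alpha> $ j))
     + 0 * Const (\<beta> $ i) * Const (\<beta> $ j))"
    unfolding \<theta> by (simp add: fun_eq_iff pd_uminus pd_mult pd_lin pd_wedge pd_power2 algebra_simps)
  moreover have "theta_uuxx ?f \<in> polys_XU"
    unfolding \<theta> by (intro polys_in.mult polys_in_power polys_in_uminus polys_in_numeral lin_in wedge_in)
  ultimately show ?thesis
    by (simp only: F_eq adjugate_form_rank_2) simp
qed

lemma F_sum_two_cubes_nonzero:
  assumes "lin_indep [lin \<alpha>, lin \<beta>]"
  shows "F_6u (lin \<alpha> ^ 3 + lin \<beta> ^ 3) \<noteq> 0"
proof
  assume 0: "F_6u (lin \<alpha> ^ 3 + lin \<beta> ^ 3) = 0"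
  have D: "triple_prod u (($) \<alpha>) (($) \<beta>) = 0" for u
  proof -
    define \<sigma> where "\<sigma> v = (case v of U i \<Rightarrow> u i | _ \<Rightarrow> 0)" for v
    have "eval \<sigma> (wedge \<alpha> \<beta>) = triple_prod u (($) \<alpha>) (($) \<beta>)"
      by (simp add: triple_prod_def eval_simps eval_diff \<sigma>_def)
    moreover have "eval \<sigma> (F_6u (lin \<alpha> ^ 3 + lin \<beta> ^ 3)) = 0"
      by (simp add: 0 eval_simps)
    ultimately show ?thesis
      by (simp add: F_sum_two_cubes eval_scale eval_uminus id.insertion_power)
  qed
  have 12: "\<alpha> $ 1 * \<beta> $ 2 = \<alpha> $ 2 * \<beta> $ 1" and 13: "\<alpha> $ 1 * \<beta> $ 3 = \<alpha> $ 3 * \<beta> $ 1"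
    and 23: "\<alpha> $ 2 * \<beta> $ 3 = \<alpha> $ 3 * \<beta> $ 2"
    \<comment> \<open>Unit vectors for \<open>u\<close> extract the three 2x2 minors of \<alpha> and
      \<beta>, whose vanishing yields linear relations with coefficients \<beta>_j and
      -\<alpha>_j.\<close>
    using D[of "\<lambda>i. if i = 3 then 1 else 0"] D[of "\<lambda>i. if i = 2 then 1 else 0"] D[of "\<lambda>i. if i = 1 then 1 else 0"]
    by (simp_all add: triple_prod_def)
  have "\<alpha> $ i * \<beta> $ j = \<alpha> $ j * \<beta> $ i" for i j
    using exhaust_3[of i] exhaust_3[of j] 12 13 23 by auto
  then have "\<beta> $ j *s \<alpha> + (- \<alpha> $ j) *s \<beta> = 0" for j
    by (simp add: vec_eq_iff mult.commute)
  then have "scale (\<beta> $ j) (lin \<alpha>) + scale (- \<alpha> $ j) (lin \<beta>) = 0" for j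
    using lin_combination[of "\<beta> $ j" \<alpha> "- \<alpha> $ j" \<beta>] by (simp add: lin_def)
  then have "\<alpha> $ j = 0" for j
    using assms unfolding lin_indep_2_iff by (metis neg_equal_0_iff_equal)
  then have "lin \<alpha> = 0"
    by (simp add: lin_def)
  then have "scale 1 (lin \<alpha>) + scale 0 (lin \<beta>) = 0"
    by simp
  then show False
    using assms unfolding lin_indep_2_iff by (metis one_neq_zero)
qed

lemma Delta_F_sum_two_cubes:
  assumes "is_form 1 a" "is_form 1 b" "lin_indep [a, b]"
  shows "Delta_xxx (a ^ 3 + b ^ 3) = 0 \<and> F_6u (a ^ 3 + b ^ 3) \<noteq> 0"
  using assms F_sum_two_cubes_nonzero Delta_sum_two_cubes unfolding is_form_1_iff by blast

text \<open>The proportionality constant is absorbed into the third factor, which leaves a square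
  times a linear form.\<close>

lemma F_repeated_factor:
  assumes "is_form 1 a" "is_form 1 b" "is_form 1 c" "\<not> lin_indep [a, b]"
  shows "F_6u (a * b * c) = 0"
proof -
  obtain \<alpha> \<beta> \<gamma> where abc: "a = lin \<alpha>" "b = lin \<beta>" "c = lin \<gamma>"
    using assms unfolding is_form_1_iff by blast
  from assms(4) show ?thesis
  proof (cases rule: not_lin_indepE)
    case (1 k)
    then have "a * b * c = b\<^sup>2 * lin (k *s \<gamma>)"
      by (simp add: lin_scale abc scale_def power2_eq_square mult_ac)
    then show ?thesis
      by (simp add: abc F_square_times)
  next
    case (2 k)
    then have "a * b * c = a\<^sup>2 * lin (k *s \<gamma>)"
      by (simp add: lin_scale abc scale_def power2_eq_square mult_ac)
    then show ?thesis
      by (simp add: abc F_square_times)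
  qed
qed

lemma not_lin_indep_3:
  assumes "{a, b, c} \<subseteq> mpoly.span {p, q}"
  shows "\<not> lin_indep [a, b, c]"
proof
  assume "lin_indep [a, b, c]"
  then have "card {a, b, c} = 3" "mpoly.independent {a, b, c}"
    by (simp_all add: lin_indep_def)
  moreover have "card {p, q} \<le> 2"
    by (simp add: card_insert_if)
  ultimately show False
    using mpoly.independent_span_bound[of "{p, q}" "{a, b, c}"] assms by simp
qed

lemma eval_adjugate_form:
  "eval \<sigma> (adjugate_form A u) = adjugate_form (\<lambda>i j. eval \<sigma> (A i j)) (\<lambda>i. eval \<sigma> (u i))"
  by (simp add: adjugate_form_def eval_simps eval_diff)

lemma adjugate_form_scale:
  "adjugate_form (\<lambda>i j. c * A i j) u = c\<^sup>2 * adjugate_form A u"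
  by (simp add: adjugate_form_def power2_eq_square algebra_simps)

lemma hessian_zero_imp_product:
  assumes f: "is_form 3 f" and \<Delta>: "Delta_xxx f = 0" and F: "F_6u f \<noteq> 0"
  shows "\<exists>a b c. is_form 1 a \<and> is_form 1 b \<and> is_form 1 c \<and> \<not> lin_indep [a, b, c] \<and>
    lin_indep [a, b] \<and> lin_indep [a, c] \<and> lin_indep [b, c] \<and> f = a * b * c"
proof -
  obtain T where T: "symmetric3 T" and fT: "f = cubic T"
    using is_form_3_symmetric[OF f] .
  have fin: "f \<in> polys_XU"
    by (simp add: fT cubic_in)
  have det: "det (contract T v) = 0" for v
  proof -
    define \<sigma> where "\<sigma> w = (case w of X i \<Rightarrow> v $ i | _ \<Rightarrow> 0)" for w
    have "eval \<sigma> (det (\<chi> i j. hess f i j)) = 216 * det (contract T v)"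
      by (simp add: det_3 eval_diff eval_simps fT eval_hess_cubic[OF T] \<sigma>_def algebra_simps)
    moreover have "eval \<sigma> (Delta_xxx f) = 0"
      by (simp add: \<Delta> eval_simps)
    ultimately show ?thesis
      by (simp add: Delta_eq[OF fin] eval_scale)
  qed
  \<comment> \<open>\<open>F_6u\<close> is computed from \<theta> alone. A point where \<theta> is
    nonzero provides the \<open>x\<close> and \<open>u\<close> for
    \<open>cubic_is_binary\<close>.\<close>
  have "theta_uuxx f \<noteq> 0"
  proof
    assume 0: "theta_uuxx f = 0"
    have "theta_uuxx f \<in> polys_XU"
      unfolding 0 by auto
    then have "F_6u f = 0"
      by (simp add: F_eq 0 adjugate_form_def)
    with F show False ..
  qed
  then obtain \<sigma> where \<sigma>: "eval \<sigma> (theta_uuxx f) \<noteq> 0"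
    using eval_eq_0D by blast
  define x where "x = (\<chi> i. \<sigma> (X i))"
  define u where "u = (\<chi> i. \<sigma> (U i))"
  have \<sigma>U: "(\<lambda>i. \<sigma> (U i)) = ($) u"
    by (simp add: u_def fun_eq_iff)
  have "eval \<sigma> (theta_uuxx f) = 36 * adjugate_form (\<lambda>i j. contract T x $ i $ j) (($) u)"
    unfolding theta_eq[OF fin] eval_adjugate_form
    by (simp add: fT eval_hess_cubic[OF T] adjugate_form_scale x_def \<sigma>U id.insertion_Var)
  then have nz: "adjugate_form (\<lambda>i j. contract T x $ i $ j) (($) u) \<noteq> 0"
    using \<sigma> by auto
  obtain s t c0 c1 c2 c3 where bin:
    "\<And>v. trilinear T v v v = c0 * dot s v ^ 3 + c1 * (dot s v)\<^sup>2 * dot t v + c2 * dot s v * (dot t v)\<^sup>2 + c3 * dot t v ^ 3"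
    by (rule cubic_is_binary[OF T det nz]) blast
  obtain a1 a2 b1 b2 d1 d2 where fac:
    "\<And>s t. c0 * s ^ 3 + c1 * s\<^sup>2 * t + c2 * s * t\<^sup>2 + c3 * t ^ 3 = (a1 * s + a2 * t) * (b1 * s + b2 * t) * (d1 * s + d2 * t)"
    by (rule binary_cubic_factors[of c0 c1 c2 c3]) blast
  define a where "a = lin (a1 *s s + a2 *s t)"
  define b where "b = lin (b1 *s s + b2 *s t)"
  define d where "d = lin (d1 *s s + d2 *s t)"
  have forms: "is_form 1 a" "is_form 1 b" "is_form 1 d"
    unfolding a_def b_def d_def by (rule is_form_lin)+
  have fabd: "f = a * b * d"
    by (rule eval_eqI)
      (simp add: fT eval_cubic bin fac a_def b_def d_def eval_simps lin_combination eval_scale eval_lin)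
  have "lin (k *s s + l *s t) \<in> mpoly.span {lin s, lin t}" for k l
    unfolding lin_combination
    by (intro mpoly.span_add mpoly.span_scale mpoly.span_base) auto
  then have "\<not> lin_indep [a, b, d]"
    by (intro not_lin_indep_3[of _ _ _ "lin s" "lin t"]) (simp add: a_def b_def d_def)
  \<comment> \<open>Any two proportional factors would make F vanish.\<close>
  moreover have "lin_indep [a, b]"
    using F_repeated_factor[of a b d] forms F fabd by auto
  moreover have "lin_indep [a, d]"
    using F_repeated_factor[of a d b] forms F fabd by (auto simp: mult_ac)
  moreover have "lin_indep [b, d]"
    using F_repeated_factor[of b d a] forms F fabd by (auto simp: mult_ac)
  ultimately show ?thesis
    using forms fabd by blast
qed

section \<open>Sums of two cubes\<close>

lemma ex_cube_root: "\<exists>c::complex. c ^ 3 = m"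
proof -
  have "degree [:- m, 0, 0, 1:] > 0"
    by simp
  then obtain c where "poly [:- m, 0, 0, 1:] c = 0"
    using alg_closed_imp_poly_has_root by blast
  then show ?thesis
    by (intro exI[of _ c]) (simp add: power3_eq_cube mult.assoc)
qed

lemma is_form_scale_1: "is_form 1 a \<Longrightarrow> is_form 1 (scale c a)"
  unfolding is_form_1_iff by (metis lin_scale)

text \<open>With a primitive cube root of unity \<open>\<omega>\<close>, the product \<open>A B (A + B)\<close> is proportional to
  \<open>(A - \<omega> B)\<^sup>3 - (A - \<omega>\<^sup>2 B)\<^sup>3\<close>.\<close>

lemma product_eq_sum_two_cubes:
  assumes forms: "is_form 1 a" "is_form 1 b" "is_form 1 c" and dep: "\<not> lin_indep [a, b, c]"
    and ab: "lin_indep [a, b]" and ac: "lin_indep [a, c]" and bc: "lin_indep [b, c]"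
  shows "\<exists>p q. is_form 1 p \<and> is_form 1 q \<and> lin_indep [p, q] \<and> a * b * c = p ^ 3 + q ^ 3"
proof -
  \<comment> \<open>Pairwise independence makes the three forms distinct, so the failure of
    \<open>lin_indep\<close> is a genuine dependence of the set.\<close>
  have "mpoly.dependent (insert c {a, b})"
    using dep ab ac bc by (simp add: lin_indep_def insert_commute)
  moreover have "mpoly.independent {a, b}"
    using ab by (simp add: lin_indep_def)
  ultimately have "c \<in> mpoly.span {a, b}"
    using mpoly.independent_insertI by blast
  then obtain k l where c: "c = scale k a + scale l b"
    by (auto simp: mpoly.span_insert mpoly.span_singleton algebra_simps)
  have "k \<noteq> 0"
  proof
    assume "k = 0"
    then have "scale l b + scale (- 1) c = 0"
      by (simp add: c)
    then show False
      using bc unfolding lin_indep_2_iff by (metis neg_equal_0_iff_equal one_neq_zero)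
  qed
  have "l \<noteq> 0"
  proof
    assume "l = 0"
    then have "scale k a + scale (- 1) c = 0"
      by (simp add: c)
    then show False
      using ac unfolding lin_indep_2_iff by (metis neg_equal_0_iff_equal one_neq_zero)
  qed
  define \<omega> where "\<omega> = Complex (- 1 / 2) (sqrt 3 / 2)"
  have \<omega>: "\<omega>\<^sup>2 = - 1 - \<omega>"
    by (simp add: \<omega>_def complex_eq_iff power2_eq_square field_simps)
  have \<omega>': "\<omega>\<^sup>2 - \<omega> \<noteq> 0"
    unfolding \<omega> by (simp add: \<omega>_def complex_eq_iff)
  \<comment> \<open>For A = k a and B = l b, the difference of cubes is 3 (\<omega>^2 - \<omega>) A
    B (A + B), and A B (A + B) = k l a b c. The cube roots \<open>g\<close> and \<open>h\<close>
    absorb the normalizing factors \<open>m\<close> and \<open>-m\<close>.\<close>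
  define m where "m = 1 / (3 * k * l * (\<omega>\<^sup>2 - \<omega>))"
  have m: "m * (3 * k * l * (\<omega>\<^sup>2 - \<omega>)) = 1"
    using \<open>k \<noteq> 0\<close> \<open>l \<noteq> 0\<close> \<omega>' by (simp add: m_def)
  obtain g h where g: "g ^ 3 = m" and h: "h ^ 3 = - m"
    using ex_cube_root by metis
  define p where "p = scale (g * k) a + scale (- g * \<omega> * l) b"
  define q where "q = scale (h * k) a + scale (- h * \<omega>\<^sup>2 * l) b"
  have "m \<noteq> 0"
    using m by auto
  then have "g \<noteq> 0" "h \<noteq> 0"
    using g h by auto
  have "is_form 1 p" "is_form 1 q"
    unfolding p_def q_def by (intro is_form_add is_form_scale_1 forms)+
  moreover have "lin_indep [p, q]"
    unfolding p_def q_def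
  proof (rule lin_indep_transform[OF ab])
    have "g * k * (- h * \<omega>\<^sup>2 * l) - h * k * (- g * \<omega> * l) = - (g * h * k * l * (\<omega>\<^sup>2 - \<omega>))"
      by (simp add: algebra_simps)
    also have "\<dots> \<noteq> 0"
      using \<open>k \<noteq> 0\<close> \<open>l \<noteq> 0\<close> \<open>g \<noteq> 0\<close> \<open>h \<noteq> 0\<close> \<omega>' by simp
    finally show "g * k * (- h * \<omega>\<^sup>2 * l) - h * k * (- g * \<omega> * l) \<noteq> 0" .
  qed
  moreover have "a * b * c = p ^ 3 + q ^ 3"
  proof (rule eval_eqI)
    fix \<sigma>
    have "x * y * (k * x + l * y) = (g * k * x + - g * \<omega> * l * y) ^ 3 + (h * k * x + - h * \<omega>\<^sup>2 * l * y) ^ 3" for x y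
    proof -
      have "(g * k * x + - g * \<omega> * l * y) ^ 3 + (h * k * x + - h * \<omega>\<^sup>2 * l * y) ^ 3 =
        g ^ 3 * (k * x - \<omega> * l * y) ^ 3 + h ^ 3 * (k * x - \<omega>\<^sup>2 * l * y) ^ 3"
        by algebra
      also have "\<dots> = m * ((k * x - \<omega> * l * y) ^ 3 - (k * x - \<omega>\<^sup>2 * l * y) ^ 3)"
        by (simp add: g h algebra_simps)
      also have "\<dots> = m * (3 * k * l * (\<omega>\<^sup>2 - \<omega>)) * (x * y * (k * x + l * y))"
        using \<omega> by algebra
      finally show ?thesis
        by (simp add: m)
    qed
    then show "eval \<sigma> (a * b * c) = eval \<sigma> (p ^ 3 + q ^ 3)"
      by (simp add: c p_def q_def eval_simps eval_scale eval_diff)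
  qed
  ultimately show ?thesis
    by blast
qed

section \<open>Waring rank two\<close>

lemma F_cube: "is_form 1 l \<Longrightarrow> F_6u (l ^ 3) = 0"
  unfolding is_form_1_iff using F_square_times by (auto simp: power3_eq_cube power2_eq_square)

text \<open>The lower bound holds because F vanishes on every sum of fewer than two cubes.\<close>

lemma waring_rank_sum_two_cubes:
  assumes "is_form 1 a" "is_form 1 b" "lin_indep [a, b]"
  shows "waring_rank 3 (a ^ 3 + b ^ 3) = 2"
proof (rule antisym)
  let ?f = "a ^ 3 + b ^ 3"
  have "\<exists>l. (\<forall>i<(2::nat). is_form 1 (l i)) \<and> ?f = (\<Sum>i<2. l i ^ 3)"
    using assms by (intro exI[of _ "\<lambda>i. if i = 0 then a else b"]) (simp add: numeral_2_eq_2)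
  then have "waring_rank 3 ?f \<le> enat 2"
    unfolding waring_rank_def by (intro Inf_lower) blast
  then show "waring_rank 3 ?f \<le> 2"
    by (simp add: numeral_eq_enat)
  have "enat 2 \<le> enat r" if l: "\<forall>i<r. is_form 1 (l i)" "?f = (\<Sum>i<r. l i ^ 3)" for r l
  proof (rule ccontr)
    assume "\<not> enat 2 \<le> enat r"
    then consider "r = 0" | "r = 1"
      by fastforce
    then have "F_6u ?f = 0"
    proof cases
      case 1
      \<comment> \<open>The empty sum is the cube of the zero form.\<close>
      have "is_form 1 0"
        by (simp add: is_form_def)
      then show ?thesis
        using F_cube[of 0] l(2) 1 by simp
    next
      case 2
      then show ?thesis
        using F_cube[of "l 0"] l by simp
    qed
    then show False
      using Delta_F_sum_two_cubes[OF assms] by simp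
  qed
  then have "enat 2 \<le> waring_rank 3 ?f"
    unfolding waring_rank_def by (intro Inf_greatest) blast
  then show "2 \<le> waring_rank 3 ?f"
    by (simp add: numeral_eq_enat)
qed

text \<open>A finite infimum is attained, which gives two cubes. If the two forms were proportional,
  the cubes would merge into a multiple of one cube, hence into one cube, contradicting rank
  two.\<close>

lemma waring_rank_2_imp_sum_two_cubes:
  assumes "waring_rank 3 f = 2"
  shows "\<exists>a b. is_form 1 a \<and> is_form 1 b \<and> lin_indep [a, b] \<and> f = a ^ 3 + b ^ 3"
proof -
  define S where "S = {enat r | r. \<exists>l. (\<forall>i<r. is_form 1 (l i)) \<and> f = (\<Sum>i<r. l i ^ 3)}"
  have S: "Inf S = 2"
    using assms by (simp add: waring_rank_def S_def)
  then have "S \<noteq> {}"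
    by (auto simp: Inf_enat_def)
  then have "Inf S \<in> S"
    by (auto simp: Inf_enat_def intro: LeastI)
  then have "enat 2 \<in> S"
    by (simp add: S numeral_eq_enat)
  then obtain l where l: "\<And>i. i < (2::nat) \<Longrightarrow> is_form 1 (l i)" "f = (\<Sum>i<2. l i ^ 3)"
    unfolding S_def by auto
  have one: False if "is_form 1 p" "f = scale m (p ^ 3)" for p m
  proof -
    obtain c where c: "c ^ 3 = m"
      using ex_cube_root by blast
    have "f = (scale c p) ^ 3"
      by (simp add: that(2) scale_def power_mult_distrib flip: c Const_power)
    then have "enat 1 \<in> S"
      unfolding S_def using is_form_scale_1[OF that(1), of c]
      by (auto intro!: exI[of _ 1] exI[of _ "\<lambda>_. scale c p"])
    then have "Inf S \<le> enat 1"
      by (rule Inf_lower)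
    then show False
      by (simp add: S numeral_eq_enat)
  qed
  have f: "f = l 0 ^ 3 + l 1 ^ 3"
    using l(2) by (simp add: numeral_2_eq_2)
  have "lin_indep [l 0, l 1]"
  proof (rule ccontr)
    assume "\<not> lin_indep [l 0, l 1]"
    then show False
    proof (cases rule: not_lin_indepE)
      case (1 k)
      then have "f = scale (k ^ 3 + 1) (l 1 ^ 3)"
        by (simp add: f scale_def power_mult_distrib Const_add Const_power algebra_simps)
      then show False
        using one[of "l 1" "k ^ 3 + 1"] l(1)[of 1] by simp
    next
      case (2 k)
      then have "f = scale (1 + k ^ 3) (l 0 ^ 3)"
        by (simp add: f scale_def power_mult_distrib Const_add Const_power algebra_simps)
      then show False
        using one[of "l 0" "1 + k ^ 3"] l(1)[of 0] by simp
    qed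
  qed
  then show ?thesis
    using f l(1) by (intro exI[of _ "l 0"] exI[of _ "l 1"]) simp
qed

theorem lemma5p2:
  fixes f :: mpoly
  assumes "is_form 3 f"
  defines "S1 \<equiv> Delta_xxx f = 0 \<and> F_6u f \<noteq> 0"
    and "S2 \<equiv> \<exists>a b. is_form 1 a \<and> is_form 1 b \<and> lin_indep [a, b] \<and> f = a ^ 3 + b ^ 3"
    and "S3 \<equiv> \<exists>a b c. is_form 1 a \<and> is_form 1 b \<and> is_form 1 c \<and>
           \<not> lin_indep [a, b, c] \<and>
           lin_indep [a, b] \<and> lin_indep [a, c] \<and> lin_indep [b, c] \<and>
           f = a * b * c"
    and "S4 \<equiv> waring_rank 3 f = 2"
  shows "(S1 \<longleftrightarrow> S2) \<and> (S2 \<longleftrightarrow> S3) \<and> (S3 \<longleftrightarrow> S4)"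
proof -
  have "S1 \<Longrightarrow> S3"
    unfolding S1_def S3_def using hessian_zero_imp_product[OF assms(1)] by blast
  moreover have "S3 \<Longrightarrow> S2"
    unfolding S3_def S2_def using product_eq_sum_two_cubes by blast
  moreover have "S2 \<Longrightarrow> S1"
    unfolding S2_def S1_def using Delta_F_sum_two_cubes by blast
  moreover have "S2 \<Longrightarrow> S4"
    unfolding S2_def S4_def using waring_rank_sum_two_cubes by blast
  moreover have "S4 \<Longrightarrow> S2"
    unfolding S2_def S4_def by (rule waring_rank_2_imp_sum_two_cubes)
  ultimately show ?thesis
    by blast
qed

end
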